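(* The following statements hold, where for real numbers $\varphi_0<\varphi_1$ we set $\varepsilon_0=1/(\varphi_1-\varphi_0)$. (i) Fix $\varphi_0<\varphi_1$. There exists $\varepsilon_1\in(0,\varepsilon_0)$ such that for any $\varepsilon\in(\varepsilon_1,\varepsilon_0)$ the set $\mathscr P_\varepsilon(\rho)$ is a singleton for any $\rho\in M$. (ii) Fix $\varepsilon>0$. There exists $\delta\in(0,\varepsilon^{-1})$ such that for any $\varphi_0,\varphi_1$ with $0<\varphi_1-\varphi_0<\delta$ the set $\mathscr P_\varepsilon(\rho)$ is a singleton for any $\rho\in M$. (iii) Fix $\varphi_0<\varphi_1$ and $\varepsilon\in(0,\varepsilon_0)$. If $\rho\in M$ is in $C^1([0,1])$ and strictly increasing, then the set $\mathscr P_\varepsilon(\rho)$ is a singleton.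
   Context: $M=\{\rho\in L^\infty([0,1]):0\le\rho\le1\}$. Given $\varphi_0<\varphi_1$, $\mathcal F$ is the set of functions $\varphi:[0,1]\to\mathbb R$ of the form $\varphi(x)=\varphi_0+\mu([0,x])$ with $\mu$ a positive Borel measure on $[0,1]$ of total mass $\varphi_1-\varphi_0$. For $\varepsilon\in(0,\varepsilon_0)$ and $\rho\in M$, the operator $K_{\rho,\varepsilon}:\mathcal F\to\mathcal F$ is $$(K_{\rho,\varepsilon}\varphi)(x)=\varphi_0+\frac1\varepsilon\int_0^x\frac{A\exp\{\frac1\varepsilon\int_0^y[(1+e^{\varphi})^{-1}-\rho]dz\}}{1+A\exp\{\frac1\varepsilon\int_0^y[(1+e^{\varphi})^{-1}-\rho]dz\}}\,dy,$$ where $A=A(\varepsilon,\rho,\varphi)\in(0,\infty)$ is the unique number such that $(K_{\rho,\varepsilon}\varphi)(1)=\varphi_1$. $\mathscr P_\varepsilon(\rho)$ is the set of fixed points of $K_{\rho,\varepsilon}$ in $\mathcal F$ (it depends also on $\varphi_0,\varphi_1$). *)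

theory Defs
  imports "HOL-Analysis.Analysis"
begin

text \<open>Elements of \<open>L\<^sup>\<infinity>([0,1])\<close> are represented by Lebesgue measurable functions;
  everything below depends on \<open>\<rho>\<close> only through its almost-everywhere class on \<open>[0,1]\<close>.\<close>

definition density_space :: "(real \<Rightarrow> real) set" where
  "density_space = {\<rho>. \<rho> \<in> borel_measurable (lebesgue_on {0..1}) \<and>
     (AE x in lebesgue_on {0..1}. 0 \<le> \<rho> x \<and> \<rho> x \<le> 1)}"

text \<open>Functions on \<open>[0,1]\<close> are encoded extensionally (\<open>undefined\<close> outside \<open>[0,1]\<close>), so that
  HOL equality is equality at every point of \<open>[0,1]\<close>. The measure \<open>\<mu>\<close> may charge the point \<open>0\<close>,
  so \<open>\<phi> 0\<close> may exceed \<open>\<phi>0\<close>.\<close>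

definition potential_space :: "real \<Rightarrow> real \<Rightarrow> (real \<Rightarrow> real) set" where
  "potential_space \<phi>0 \<phi>1 = {\<phi>. \<exists>\<mu> :: real measure.
     sets \<mu> = sets (restrict_space borel {0..1}) \<and>
     emeasure \<mu> {0..1} = ennreal (\<phi>1 - \<phi>0) \<and>
     \<phi> = (\<lambda>x\<in>{0..1}. \<phi>0 + measure \<mu> {0..x})}"

definition exp_weight :: "(real \<Rightarrow> real) \<Rightarrow> real \<Rightarrow> (real \<Rightarrow> real) \<Rightarrow> real \<Rightarrow> real" where
  "exp_weight \<rho> \<epsilon> \<phi> y =
     exp (1 / \<epsilon> * (LINT z:{0..y}|lebesgue. inverse (1 + exp (\<phi> z)) - \<rho> z))"

definition K_with ::
  "real \<Rightarrow> (real \<Rightarrow> real) \<Rightarrow> real \<Rightarrow> (real \<Rightarrow> real) \<Rightarrow> real \<Rightarrow> real \<Rightarrow> real" where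
  "K_with \<phi>0 \<rho> \<epsilon> \<phi> A x = \<phi>0 + 1 / \<epsilon> *
     (LINT y:{0..x}|lebesgue. A * exp_weight \<rho> \<epsilon> \<phi> y / (1 + A * exp_weight \<rho> \<epsilon> \<phi> y))"

text \<open>Such an \<open>A\<close> exists and is unique when \<open>0 < \<epsilon> < 1 / (\<phi>1 - \<phi>0)\<close>; outside this range
  the value is unspecified.\<close>

definition A_const ::
  "real \<Rightarrow> real \<Rightarrow> (real \<Rightarrow> real) \<Rightarrow> real \<Rightarrow> (real \<Rightarrow> real) \<Rightarrow> real" where
  "A_const \<phi>0 \<phi>1 \<rho> \<epsilon> \<phi> = (THE A. 0 < A \<and> K_with \<phi>0 \<rho> \<epsilon> \<phi> A 1 = \<phi>1)"

definition K_op ::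
  "real \<Rightarrow> real \<Rightarrow> (real \<Rightarrow> real) \<Rightarrow> real \<Rightarrow> (real \<Rightarrow> real) \<Rightarrow> (real \<Rightarrow> real)" where
  "K_op \<phi>0 \<phi>1 \<rho> \<epsilon> \<phi> = (\<lambda>x\<in>{0..1}. K_with \<phi>0 \<rho> \<epsilon> \<phi> (A_const \<phi>0 \<phi>1 \<rho> \<epsilon> \<phi>) x)"

definition fixed_points :: "real \<Rightarrow> real \<Rightarrow> real \<Rightarrow> (real \<Rightarrow> real) \<Rightarrow> (real \<Rightarrow> real) set" where
  "fixed_points \<phi>0 \<phi>1 \<epsilon> \<rho> = {\<phi> \<in> potential_space \<phi>0 \<phi>1. K_op \<phi>0 \<phi>1 \<rho> \<epsilon> \<phi> = \<phi>}"

text \<open>Derivatives at the endpoints are one-sided, unlike in \<^const>\<open>C1_differentiable_on\<close>.\<close>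

definition C1_unit_interval :: "(real \<Rightarrow> real) \<Rightarrow> bool" where
  "C1_unit_interval f \<longleftrightarrow> (\<exists>f'. continuous_on {0..1} f' \<and>
     (\<forall>x\<in>{0..1}. (f has_real_derivative f' x) (at x within {0..1})))"

end

theory Submission
  imports Defs
begin

text \<open>With \<open>w(y) = ln A + \<epsilon>\<^sup>-\<^sup>1 \<integral>\<^sub>0\<^sup>y [(1 + e\<^sup>\<phi>)\<^sup>-\<^sup>1 - \<rho>]\<close> and \<open>\<sigma>\<close> the logistic function,
  the fixed points are the solutions of the boundary value problem \<open>\<epsilon> \<phi>' = \<sigma>(w)\<close>,
  \<open>\<epsilon> w' = \<sigma>(- \<phi>) - \<rho>\<close>, \<open>\<phi>(0) = \<phi>\<^sub>0\<close>, \<open>\<phi>(1) = \<phi>\<^sub>1\<close>. As \<open>w\<close> stays within \<open>1/\<epsilon>\<close> of \<open>ln A\<close>,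
  shooting in \<open>ln A\<close> gives existence. For uniqueness let \<open>(\<phi>, w)\<close> and \<open>(\<psi>, v)\<close> be two solutions
  with \<open>w(0) < v(0)\<close>. In (i) and (ii) one of \<open>\<sigma>(w)\<close>, \<open>1 - \<sigma>(w)\<close> is uniformly small, hence so is
  \<open>\<sigma>'\<close>, and \<open>v - w\<close> stays positive, which contradicts \<open>\<psi>(1) = \<phi>(1)\<close>. In (iii) let \<open>x\<^sub>1\<close> be the first
  zero of \<open>\<psi> - \<phi>\<close> after 0. With \<open>H(w) = ln (1 + e\<^sup>w)\<close>, integration by parts gives
  \<open>H(v(x\<^sub>1)) - H(w(x\<^sub>1)) = H(v(0)) - H(w(0)) + \<integral> \<rho>' (\<psi> - \<phi>) > 0\<close> (the integral over \<open>[0, x\<^sub>1]\<close>), so \<open>\<psi> - \<phi>\<close> increases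
  strictly through its zero \<open>x\<^sub>1\<close>, although it is positive just before.\<close>

section \<open>Global solutions of Lipschitz differential equations; derivatives within an
  interval\<close>

text \<open>The Lipschitz bound is uniform in time and global in the state, so the Picard operator
  contracts on all of \<open>{a..b}\<close> at once and no local solutions have to be
  patched.\<close>

lemma picard_lindelof_global:
  fixes F :: "real \<Rightarrow> 'a::banach \<Rightarrow> 'a"
  assumes ab: "a \<le> b"
    and cont: "continuous_on ({a..b} \<times> UNIV) (\<lambda>(t, y). F t y)"
    and lip: "\<And>t x y. t \<in> {a..b} \<Longrightarrow> norm (F t x - F t y) \<le> L * norm (x - y)"
  shows "\<exists>y. y a = y0 \<and> (\<forall>t\<in>{a..b}. (y has_vector_derivative F t (y t)) (at t within {a..b}))"
proof -
  txt \<open>The Picard operator halves distances in the norm weighted by \<open>exp (- l * (t - a))\<close>.\<close>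
  define l where "l = 2 * max L 1"
  have l: "l > 0" "L \<le> l / 2" by (auto simp: l_def)
  \<comment> \<open>The unknown \<open>u\<close> stands for the solution times
    \<open>exp (- l * (s - a))\<close>; this rescaling turns the weighted norm into the plain sup
    norm of bounded continuous functions.\<close>
  define G where "G u s = F s (exp (l * (s - a)) *\<^sub>R apply_bcontfun u s)" for u s
  define P where "P u t = y0 + integral {a..t} (G u)" for u t
  \<comment> \<open>Bounded continuous functions live on the whole line; clamping time to
    \<open>{a..b}\<close> extends the Picard iterate by constants.\<close>
  define c where "c t = max a (min b t)" for t
  define T where "T u t = exp (- (l * (c t - a))) *\<^sub>R P u (c t)" for u t
  have c: "c t \<in> {a..b}" for t using ab by (auto simp: c_def)
  have c_id: "c t = t" if "t \<in> {a..b}" for t using that by (auto simp: c_def)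
  have contc: "continuous_on UNIV c" unfolding c_def by (intro continuous_intros)
  have contG: "continuous_on {a..b} (G u)" for u
  proof -
    have "continuous_on {a..b} ((\<lambda>(t, y). F t y) \<circ> (\<lambda>s. (s, exp (l * (s - a)) *\<^sub>R apply_bcontfun u s)))"
      by (intro continuous_on_compose continuous_intros continuous_on_subset[OF cont]) auto
    then show ?thesis by (simp add: G_def[abs_def] o_def)
  qed
  have intG: "G u integrable_on {a..t}" if "t \<in> {a..b}" for u t
    by (rule integrable_continuous_real, rule continuous_on_subset[OF contG]) (use that in auto)
  have derivP: "(P u has_vector_derivative G u t) (at t within {a..b})" if "t \<in> {a..b}" for u t
    unfolding P_def[abs_def]
    using integral_has_vector_derivative[OF contG that] by (auto intro!: derivative_eq_intros)
  have contP: "continuous_on {a..b} (P u)" for u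
    by (rule continuous_on_vector_derivative[OF derivP])
  have memT: "T u \<in> bcontfun" for u
  proof -
    have cT: "continuous_on {a..b} (\<lambda>t. exp (- (l * (t - a))) *\<^sub>R P u t)"
      by (intro continuous_intros contP)
    have "continuous_on UNIV ((\<lambda>t. exp (- (l * (t - a))) *\<^sub>R P u t) \<circ> c)"
      using contc c by (intro continuous_on_compose continuous_on_subset[OF cT]) (auto simp del: atLeastAtMost_iff)
    moreover have "range ((\<lambda>t. exp (- (l * (t - a))) *\<^sub>R P u t) \<circ> c)
        \<subseteq> (\<lambda>t. exp (- (l * (t - a))) *\<^sub>R P u t) ` {a..b}"
      using c by auto
    then have "bounded (range ((\<lambda>t. exp (- (l * (t - a))) *\<^sub>R P u t) \<circ> c))"
      using compact_continuous_image[OF cT] compact_imp_bounded bounded_subset by blast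
    ultimately show ?thesis by (simp add: bcontfun_def T_def[abs_def] o_def)
  qed
  define TT where "TT u = Bcontfun (T u)" for u
  have TT: "apply_bcontfun (TT u) t = T u t" for u t
    by (simp add: TT_def Bcontfun_inverse[OF memT])
  have Pdist: "norm (P u t - P v t) \<le> exp (l * (t - a)) * (dist u v / 2)" if t: "t \<in> {a..b}" for u v t
  proof -
    \<comment> \<open>Since \<open>L \<le> l / 2\<close>, the function \<open>l * ?E\<close>
      dominates the difference of the integrands, and its primitive \<open>?E\<close> grows exactly
      as fast as the weight decays.\<close>
    let ?E = "\<lambda>s. exp (l * (s - a)) * (dist u v / 2)"
    have E: "((\<lambda>s. l * ?E s) has_integral (?E t - ?E a)) {a..t}"
      using t by (intro fundamental_theorem_of_calculus)
        (auto intro!: derivative_eq_intros simp flip: has_real_derivative_iff_has_vector_derivative)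
    have "P u t - P v t = integral {a..t} (\<lambda>s. G u s - G v s)"
      using intG[OF t] by (simp add: P_def integral_diff)
    also have "norm \<dots> \<le> integral {a..t} (\<lambda>s. l * ?E s)"
    proof (rule integral_norm_bound_integral)
      fix s assume s: "s \<in> {a..t}"
      have "norm (G u s - G v s) \<le> L * (exp (l * (s - a)) * norm (apply_bcontfun u s - apply_bcontfun v s))"
        using lip[of s "exp (l * (s - a)) *\<^sub>R apply_bcontfun u s" "exp (l * (s - a)) *\<^sub>R apply_bcontfun v s"] s t
        unfolding G_def by (simp flip: scaleR_diff_right)
      also have "\<dots> \<le> (l / 2) * (exp (l * (s - a)) * dist u v)"
        using l dist_bounded[of u s v] by (intro mult_mono) (auto simp: dist_norm)
      finally show "norm (G u s - G v s) \<le> l * ?E s" by simp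
    qed (use intG[OF t] E in \<open>auto intro!: integrable_diff simp: has_integral_iff\<close>)
    also have "\<dots> = ?E t - dist u v / 2" using E by (simp add: has_integral_iff)
    also have "\<dots> \<le> ?E t" by simp
    finally show ?thesis .
  qed
  have contr: "dist (TT u) (TT v) \<le> 1/2 * dist u v" for u v
  proof (rule dist_bound)
    fix t
    have "dist (T u t) (T v t) = exp (- (l * (c t - a))) * norm (P u (c t) - P v (c t))"
      by (simp add: T_def dist_norm flip: scaleR_diff_right)
    also have "\<dots> \<le> exp (- (l * (c t - a))) * (exp (l * (c t - a)) * (dist u v / 2))"
      by (intro mult_left_mono Pdist c) auto
    also have "\<dots> = dist u v / 2" by (simp flip: exp_add add: mult.assoc[symmetric])
    finally show "dist (apply_bcontfun (TT u) t) (apply_bcontfun (TT v) t) \<le> 1/2 * dist u v"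
      by (simp add: TT)
  qed
  have "\<exists>!u. TT u = u"
    using contr by (intro banach_fix_type[where c = "1/2"]) auto
  then obtain u where u: "TT u = u" by auto
  have uP: "exp (l * (t - a)) *\<^sub>R apply_bcontfun u t = P u t" if "t \<in> {a..b}" for t
  proof -
    have "apply_bcontfun u t = exp (- (l * (t - a))) *\<^sub>R P u t"
      using TT[of u t] c_id[OF that] by (simp add: u T_def)
    then show ?thesis by (simp flip: exp_add)
  qed
  have "(P u has_vector_derivative F t (P u t)) (at t within {a..b})" if "t \<in> {a..b}" for t
    using derivP[OF that, of u] uP[OF that] by (simp add: G_def)
  moreover have "P u a = y0" by (simp add: P_def)
  ultimately show ?thesis by blast
qed

text \<open>A derivative within \<open>S\<close> restricts to \<open>{x..y}\<close>, so one-sided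
  derivatives at the ends of the unit interval are enough later on.\<close>

lemma MVT_within:
  fixes f :: "real \<Rightarrow> real"
  assumes "x < y" "{x..y} \<subseteq> S"
    and "\<And>t. t \<in> S \<Longrightarrow> (f has_real_derivative f' t) (at t within S)"
  shows "\<exists>t\<in>{x<..<y}. f y - f x = f' t * (y - x)"
proof (rule mvt_simple[OF \<open>x < y\<close>])
  fix t assume "x \<le> t" "t \<le> y"
  then have "(f has_real_derivative f' t) (at t within {x..y})"
    using assms by (intro has_field_derivative_subset[OF assms(3)]) auto
  then show "(f has_derivative (*) (f' t)) (at t within {x..y})"
    by (simp add: has_field_derivative_def)
qed

section \<open>The logistic function and its primitive\<close>

definition logistic :: "real \<Rightarrow> real" where
  "logistic w = exp w / (1 + exp w)"

lemma one_plus_exp_pos [simp]: "0 < 1 + exp (x::real)" "1 + exp (x::real) \<noteq> 0"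
  using exp_gt_zero[of x] by linarith+

lemma logistic_pos [simp]: "0 < logistic w" and logistic_less_1 [simp]: "logistic w < 1"
  by (simp_all add: logistic_def)

lemma logistic_minus: "logistic (- w) = 1 - logistic w"
  by (simp add: logistic_def exp_minus field_simps)

lemma inverse_one_plus_exp: "inverse (1 + exp p) = logistic (- p)"
  by (simp add: logistic_def exp_minus field_simps)

lemma DERIV_logistic: "(logistic has_real_derivative logistic w * (1 - logistic w)) (at w within S)"
  unfolding logistic_def[abs_def]
  by (auto intro!: derivative_eq_intros simp: field_simps)

lemma continuous_on_logistic [continuous_intros]:
  "continuous_on S g \<Longrightarrow> continuous_on S (\<lambda>x. logistic (g x))"
  unfolding logistic_def by (intro continuous_intros) auto

lemma logistic_less_iff [simp]: "logistic v < logistic w \<longleftrightarrow> v < w"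
  by (simp add: logistic_def field_simps)

lemma logistic_le_iff [simp]: "logistic v \<le> logistic w \<longleftrightarrow> v \<le> w"
  by (simp add: logistic_def field_simps)

lemma logistic_ln: "0 < q \<Longrightarrow> q < 1 \<Longrightarrow> logistic (ln (q / (1 - q))) = q"
  by (simp add: logistic_def field_simps)

lemma logistic_MVT:
  assumes "v < w"
  obtains t where "v < t" "t < w" "logistic w - logistic v = logistic t * (1 - logistic t) * (w - v)"
  using MVT_within[OF assms, of UNIV logistic "\<lambda>t. logistic t * (1 - logistic t)"] DERIV_logistic by auto

text \<open>The derivative \<open>logistic t * (1 - logistic t)\<close> is at most
  \<open>logistic t\<close>, which by monotonicity stays below \<open>c\<close> between
  \<open>v\<close> and \<open>w\<close>.\<close>

lemma logistic_diff_le: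
  assumes "logistic v \<le> c" "logistic w \<le> c"
  shows "\<bar>logistic v - logistic w\<bar> \<le> c * \<bar>v - w\<bar>"
  using assms
proof (induction v w rule: linorder_wlog)
  case (le v w)
  show ?case
  proof (cases "v < w")
    case True
    obtain t where t: "v < t" "t < w" "logistic w - logistic v = logistic t * (1 - logistic t) * (w - v)"
      using logistic_MVT[OF True] .
    have "logistic t * (1 - logistic t) \<le> c * 1"
    proof (rule mult_mono)
      have "logistic t \<le> logistic w" using t by simp
      then show "logistic t \<le> c" using le by linarith
      show "0 \<le> c" using le logistic_pos[of v] by linarith
    qed (simp_all add: less_imp_le)
    then have "logistic t * (1 - logistic t) * (w - v) \<le> c * (w - v)"
      using True by (intro mult_right_mono) auto
    moreover have "logistic v < logistic w" using True by simp
    ultimately show ?thesis using t True by (simp add: abs_if)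
  qed (use le in simp)
qed (simp add: abs_minus_commute)

text \<open>Changing the sign of the argument exchanges \<open>logistic\<close> with its
  complement.\<close>

lemma logistic_diff_le_compl:
  assumes "1 - logistic v \<le> c" "1 - logistic w \<le> c"
  shows "\<bar>logistic v - logistic w\<bar> \<le> c * \<bar>v - w\<bar>"
  using logistic_diff_le[of "- v" c "- w"] assms
  by (simp add: logistic_minus abs_minus_commute)

text \<open>The derivative has the form \<open>s * (1 - s)\<close>, which is at most
  \<open>1/4\<close> because the square of \<open>s - 1/2\<close> is nonnegative.\<close>

lemma logistic_Lipschitz: "\<bar>logistic v - logistic w\<bar> \<le> \<bar>v - w\<bar> / 4"
proof (induction v w rule: linorder_wlog)
  case (le v w)
  show ?case
  proof (cases "v < w")
    case True
    obtain t where t: "v < t" "t < w" "logistic w - logistic v = logistic t * (1 - logistic t) * (w - v)"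
      using logistic_MVT[OF True] .
    have "logistic t * (1 - logistic t) \<le> 1/4"
      using zero_le_power2[of "logistic t - 1/2"] by (simp add: power2_eq_square field_simps)
    then have "logistic t * (1 - logistic t) * (w - v) \<le> 1/4 * (w - v)"
      using True by (intro mult_right_mono) auto
    moreover have "logistic v < logistic w" using True by simp
    ultimately show ?thesis using t True by (simp add: abs_if)
  qed (use le in simp)
qed (simp add: abs_minus_commute)

lemma logistic_diff_divide_le:
  assumes "0 < \<epsilon>"
  shows "\<bar>logistic v / \<epsilon> - logistic w / \<epsilon>\<bar> \<le> \<bar>v - w\<bar> / (4 * \<epsilon>)"
  using divide_right_mono[OF logistic_Lipschitz[of v w] less_imp_le[OF assms]] assms
  by (simp flip: diff_divide_distrib)

text \<open>The shift multiplies the numerator by exactly \<open>exp c\<close>, while the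
  denominator does not decrease.\<close>

lemma logistic_add_le:
  assumes "0 \<le> c"
  shows "logistic (w + c) \<le> exp c * logistic w"
proof -
  have "exp (w + c) / (1 + exp (w + c)) \<le> exp (w + c) / (1 + exp w)"
    using assms by (intro divide_left_mono mult_pos_pos) auto
  then show ?thesis by (simp add: logistic_def exp_add mult.commute)
qed

text \<open>The primitive of \<open>logistic\<close>, called H in the idea of the proof.\<close>

definition softplus :: "real \<Rightarrow> real" where
  "softplus w = ln (1 + exp w)"

lemma softplus_has_derivative [derivative_intros]:
  assumes "(g has_real_derivative d) (at x within S)"
  shows "((\<lambda>x. softplus (g x)) has_real_derivative logistic (g x) * d) (at x within S)"
  unfolding softplus_def logistic_def
  using assms by (auto intro!: derivative_eq_intros)

lemma softplus_less_iff [simp]: "softplus v < softplus w \<longleftrightarrow> v < w"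
  by (simp add: softplus_def)

section \<open>The boundary value problem\<close>

text \<open>Here \<open>R\<close> is the primitive of \<open>\<rho>\<close> and \<open>z = w + R / \<epsilon>\<close>: in these variables the right-hand side is
  continuous even if \<open>\<rho>\<close> is not.\<close>

definition el_solution ::
  "real \<Rightarrow> (real \<Rightarrow> real) \<Rightarrow> real \<Rightarrow> real \<Rightarrow> (real \<Rightarrow> real) \<Rightarrow> (real \<Rightarrow> real) \<Rightarrow> bool" where
  "el_solution \<epsilon> R p a f z \<longleftrightarrow> f 0 = p \<and> z 0 = a \<and>
     (\<forall>x\<in>{0..1}. (f has_real_derivative logistic (z x - R x / \<epsilon>) / \<epsilon>) (at x within {0..1}) \<and>
       (z has_real_derivative logistic (- f x) / \<epsilon>) (at x within {0..1}))"

lemma el_solutionD: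
  assumes "el_solution \<epsilon> R p a f z"
  shows "f 0 = p" "z 0 = a"
    and "x \<in> {0..1} \<Longrightarrow> (f has_real_derivative logistic (z x - R x / \<epsilon>) / \<epsilon>) (at x within {0..1})"
    and "x \<in> {0..1} \<Longrightarrow> (z has_real_derivative logistic (- f x) / \<epsilon>) (at x within {0..1})"
  using assms by (auto simp: el_solution_def)

text \<open>Each component is driven by the other one through the 1/4-Lipschitz
  \<open>logistic\<close>, so the field is Lipschitz in the state with constant
  \<open>1 / (2 * \<epsilon>)\<close>, and it is continuous in time because \<open>R\<close>
  is.\<close>

lemma el_solution_exists:
  assumes "0 < \<epsilon>" "continuous_on {0..1} R"
  shows "\<exists>f z. el_solution \<epsilon> R p a f z"
proof -
  define F where "F t y = (logistic (snd y - R t / \<epsilon>) / \<epsilon>, logistic (- fst y) / \<epsilon>)" for t and y :: "real \<times> real"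
  have "\<exists>y. y 0 = (p, a) \<and> (\<forall>t\<in>{0..1}. (y has_vector_derivative F t (y t)) (at t within {0..1}))"
  proof (rule picard_lindelof_global)
    show "continuous_on ({0..1} \<times> UNIV) (\<lambda>(t, y). F t y)"
      unfolding F_def split_beta using assms
      by (intro continuous_intros continuous_on_compose2[OF assms(2)]) auto
    fix t :: real and x y :: "real \<times> real"
    have "norm (F t x - F t y) \<le> norm (fst (F t x - F t y)) + norm (snd (F t x - F t y))"
      by (simp add: norm_prod_def sqrt_sum_squares_le_sum_abs)
    also have "\<dots> \<le> norm (snd (x - y)) / (4 * \<epsilon>) + norm (fst (x - y)) / (4 * \<epsilon>)"
      using logistic_diff_divide_le[OF assms(1), of "snd x - R t / \<epsilon>" "snd y - R t / \<epsilon>"]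
        logistic_diff_divide_le[OF assms(1), of "- fst x" "- fst y"]
      by (intro add_mono) (auto simp: F_def abs_minus_commute)
    also have "\<dots> \<le> norm (x - y) / (4 * \<epsilon>) + norm (x - y) / (4 * \<epsilon>)"
      using assms(1) norm_fst_le[of "fst (x - y)" "snd (x - y)", unfolded prod.collapse]
        norm_snd_le[of "snd (x - y)" "fst (x - y)", unfolded prod.collapse]
      by (intro add_mono divide_right_mono) auto
    finally show "norm (F t x - F t y) \<le> (1 / (2 * \<epsilon>)) * norm (x - y)" using assms(1) by (simp add: field_simps)
  qed simp
  then obtain y where y: "y 0 = (p, a)"
    "\<And>t. t \<in> {0..1} \<Longrightarrow> (y has_vector_derivative F t (y t)) (at t within {0..1})" by blast
  have "el_solution \<epsilon> R p a (\<lambda>t. fst (y t)) (\<lambda>t. snd (y t))"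
    using bounded_linear.has_vector_derivative[OF bounded_linear_fst y(2)]
      bounded_linear.has_vector_derivative[OF bounded_linear_snd y(2)] y(1)
    by (auto simp: el_solution_def has_real_derivative_iff_has_vector_derivative F_def)
  then show ?thesis by blast
qed

text \<open>A Gronwall argument: the weighted squared distance \<open>Q\<close> of the two solutions
  does not increase. It gives continuity of the shooting map as well as uniqueness for given initial
  data.\<close>

lemma el_solution_stable:
  assumes \<epsilon>: "0 < \<epsilon>" and f: "el_solution \<epsilon> R p a f z" and g: "el_solution \<epsilon> R p b g u" and x: "x \<in> {0..1}"
  shows "\<bar>f x - g x\<bar> \<le> exp (1 / (2 * \<epsilon>)) * \<bar>a - b\<bar>"
proof -
  note f = el_solutionD[OF f] and g = el_solutionD[OF g]
  define D E where "D x = f x - g x" and "E x = z x - u x" for x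
  define D' where "D' x = logistic (z x - R x / \<epsilon>) / \<epsilon> - logistic (u x - R x / \<epsilon>) / \<epsilon>" for x
  define E' where "E' x = logistic (- f x) / \<epsilon> - logistic (- g x) / \<epsilon>" for x
  \<comment> \<open>The rate dominates the growth of the squared distance; the square root taken at
    the end halves it.\<close>
  define c where "c = 1 / \<epsilon>"
  define Q where "Q x = exp (- (c * x)) * ((D x)\<^sup>2 + (E x)\<^sup>2)" for x
  define Q' where "Q' x = exp (- (c * x)) * (2 * D x * D' x + 2 * E x * E' x - c * ((D x)\<^sup>2 + (E x)\<^sup>2))" for x
  have D: "(D has_real_derivative D' t) (at t within {0..1})" if "t \<in> {0..1}" for t
    unfolding D_def[abs_def] D'_def
    using f(3)[OF that] g(3)[OF that] by (rule DERIV_diff)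
  have E: "(E has_real_derivative E' t) (at t within {0..1})" if "t \<in> {0..1}" for t
    unfolding E_def[abs_def] E'_def
    using f(4)[OF that] g(4)[OF that] by (rule DERIV_diff)
  have Q: "(Q has_real_derivative Q' t) (at t within {0..1})" if "t \<in> {0..1}" for t
    unfolding Q_def[abs_def] Q'_def
    by (rule DERIV_cong, (rule derivative_intros D[OF that] E[OF that])+) (simp add: algebra_simps)
  have "Q' t \<le> 0" for t
  proof -
    have "\<bar>D' t\<bar> \<le> \<bar>E t\<bar> / (4 * \<epsilon>)" "\<bar>E' t\<bar> \<le> \<bar>D t\<bar> / (4 * \<epsilon>)"
      using logistic_diff_divide_le[OF \<epsilon>, of "z t - R t / \<epsilon>" "u t - R t / \<epsilon>"]
        logistic_diff_divide_le[OF \<epsilon>, of "- f t" "- g t"]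
      by (auto simp: D_def E_def D'_def E'_def abs_minus_commute)
    moreover have le: "\<bar>D t\<bar> * \<bar>E t\<bar> \<le> (D t)\<^sup>2 + (E t)\<^sup>2"
      using sum_squares_bound[of "\<bar>D t\<bar>" "\<bar>E t\<bar>"] mult_nonneg_nonneg[OF abs_ge_zero[of "D t"] abs_ge_zero[of "E t"]]
      unfolding power2_abs mult.assoc by linarith
    ultimately have "\<bar>D t\<bar> * \<bar>D' t\<bar> + \<bar>E t\<bar> * \<bar>E' t\<bar> \<le> \<bar>D t\<bar> * (\<bar>E t\<bar> / (4 * \<epsilon>)) + \<bar>E t\<bar> * (\<bar>D t\<bar> / (4 * \<epsilon>))"
      by (intro add_mono mult_left_mono) auto
    also have "\<dots> = \<bar>D t\<bar> * \<bar>E t\<bar> / (2 * \<epsilon>)" using \<epsilon> by (simp add: field_simps)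
    also have "\<dots> \<le> ((D t)\<^sup>2 + (E t)\<^sup>2) / (2 * \<epsilon>)"
      using \<epsilon> le by (intro divide_right_mono) auto
    finally have "2 * (\<bar>D t\<bar> * \<bar>D' t\<bar> + \<bar>E t\<bar> * \<bar>E' t\<bar>) \<le> ((D t)\<^sup>2 + (E t)\<^sup>2) / \<epsilon>"
      by (simp add: field_simps)
    moreover have "D t * D' t \<le> \<bar>D t\<bar> * \<bar>D' t\<bar>" "E t * E' t \<le> \<bar>E t\<bar> * \<bar>E' t\<bar>"
      by (simp_all flip: abs_mult)
    ultimately have "2 * D t * D' t + 2 * E t * E' t - c * ((D t)\<^sup>2 + (E t)\<^sup>2) \<le> 0" by (simp add: c_def)
    then show ?thesis by (simp add: Q'_def mult_le_0_iff)
  qed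
  moreover have "x = 0 \<or> (\<exists>t. Q x - Q 0 = Q' t * (x - 0))"
    using MVT_within[of 0 x "{0..1}" Q Q', OF _ _ Q] x by fastforce
  ultimately have "Q x \<le> Q 0"
    using x mult_nonpos_nonneg[of _ x] by (metis atLeastAtMost_iff diff_le_0_iff_le diff_zero order_refl)
  then have "(D x)\<^sup>2 + (E x)\<^sup>2 \<le> exp (x / \<epsilon>) * (a - b)\<^sup>2"
    using f g by (simp add: Q_def D_def E_def c_def exp_minus field_simps)
  also have "\<dots> \<le> exp (1 / \<epsilon>) * (a - b)\<^sup>2"
    using x \<epsilon> by (intro mult_right_mono) (auto simp: field_simps)
  also have "\<dots> = (exp (1 / (2 * \<epsilon>)) * \<bar>a - b\<bar>)\<^sup>2"
    by (simp add: power_mult_distrib flip: exp_double)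
  finally have "\<bar>D x\<bar>\<^sup>2 \<le> (exp (1 / (2 * \<epsilon>)) * \<bar>a - b\<bar>)\<^sup>2"
    using zero_le_power2[of "E x"] unfolding power2_abs by linarith
  then show ?thesis unfolding D_def by (rule power2_le_imp_le) simp
qed

text \<open>Both \<open>z x - a\<close> and \<open>R x / \<epsilon>\<close> lie between 0 and
  \<open>x / \<epsilon>\<close>, since the slope of \<open>z\<close> lies between 0 and
  \<open>1 / \<epsilon>\<close>.\<close>

lemma el_solution_drift:
  assumes \<epsilon>: "0 < \<epsilon>" and f: "el_solution \<epsilon> R p a f z" and x: "x \<in> {0..1}" and R: "0 \<le> R x" "R x \<le> x"
  shows "\<bar>z x - R x / \<epsilon> - a\<bar> \<le> 1 / \<epsilon>"
proof -
  have "0 \<le> z x - a \<and> z x - a \<le> x / \<epsilon>"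
  proof (cases "x = 0")
    case False
    then obtain t where "t \<in> {0<..<x}" and t: "z x - z 0 = logistic (- f t) / \<epsilon> * (x - 0)"
      using MVT_within[of 0 x "{0..1}" z, OF _ _ el_solutionD(4)[OF f]] x by auto
    then show ?thesis
      using \<epsilon> x el_solutionD(2)[OF f] less_imp_le[OF logistic_less_1, of "- f t"] less_imp_le[OF logistic_pos, of "- f t"]
      by (auto intro!: divide_right_mono mult_left_le_one_le)
  qed (use el_solutionD(2)[OF f] in auto)
  moreover have "0 \<le> R x / \<epsilon>" "R x / \<epsilon> \<le> x / \<epsilon>" "x / \<epsilon> \<le> 1 / \<epsilon>"
    using \<epsilon> R x by (auto intro!: divide_right_mono)
  ultimately show ?thesis by linarith
qed

text \<open>By the mean value theorem the increment is a value of \<open>logistic\<close> at an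
  argument within \<open>1 / \<epsilon>\<close> of \<open>a\<close>. This ties the boundary value at
  1 to the shooting parameter.\<close>

lemma el_solution_increment:
  assumes \<epsilon>: "0 < \<epsilon>" and f: "el_solution \<epsilon> R p a f z" and R: "\<And>x. x \<in> {0..1} \<Longrightarrow> 0 \<le> R x \<and> R x \<le> x"
  shows "logistic (a - 1 / \<epsilon>) \<le> \<epsilon> * (f 1 - p)" "\<epsilon> * (f 1 - p) \<le> logistic (a + 1 / \<epsilon>)"
proof -
  obtain t :: real where t: "t \<in> {0<..<1}" "f 1 - f 0 = logistic (z t - R t / \<epsilon>) / \<epsilon> * (1 - 0)"
    using MVT_within[of 0 1 "{0..1}" f, OF _ _ el_solutionD(3)[OF f]] by auto
  have eq: "\<epsilon> * (f 1 - p) = logistic (z t - R t / \<epsilon>)"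
    using t el_solutionD(1)[OF f] \<epsilon> by simp
  have "\<bar>z t - R t / \<epsilon> - a\<bar> \<le> 1 / \<epsilon>"
    using t R[of t] by (intro el_solution_drift[OF \<epsilon> f]) auto
  then show "logistic (a - 1 / \<epsilon>) \<le> \<epsilon> * (f 1 - p)" "\<epsilon> * (f 1 - p) \<le> logistic (a + 1 / \<epsilon>)"
    unfolding eq logistic_le_iff by linarith+
qed

section \<open>Existence for the boundary value problem by shooting\<close>

lemma el_boundary_solution_exists:
  assumes \<epsilon>: "0 < \<epsilon>" and pq: "p < q" "\<epsilon> * (q - p) < 1" and cont: "continuous_on {0..1} R"
    and R: "\<And>x. x \<in> {0..1} \<Longrightarrow> 0 \<le> R x \<and> R x \<le> x"
  shows "\<exists>a f z. el_solution \<epsilon> R p a f z \<and> f 1 = q"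
proof -
  \<comment> \<open>One solution is chosen for each \<open>a\<close>; stability makes its value at 1
    Lipschitz in \<open>a\<close>.\<close>
  obtain f z where sol: "\<And>a. el_solution \<epsilon> R p a (f a) (z a)"
    using el_solution_exists[OF \<epsilon> cont] by metis
  \<comment> \<open>At \<open>L\<close> the logistic function takes the prescribed mean value;
    moving \<open>a\<close> from \<open>L\<close> by the drift bound \<open>1 / \<epsilon>\<close>
    to either side forces the end value below or above \<open>q\<close>.\<close>
  define L where "L = ln (\<epsilon> * (q - p) / (1 - \<epsilon> * (q - p)))"
  have L: "logistic L = \<epsilon> * (q - p)"
    using \<epsilon> pq unfolding L_def by (intro logistic_ln) auto
  have "(exp (1 / (2 * \<epsilon>)))-lipschitz_on UNIV (\<lambda>a. f a 1)"
    using el_solution_stable[OF \<epsilon> sol sol, of 1] by (intro lipschitz_onI) (auto simp: dist_real_def)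
  then have cont1: "continuous_on {L - 1 / \<epsilon>..L + 1 / \<epsilon>} (\<lambda>a. f a 1)"
    using lipschitz_on_continuous_on continuous_on_subset by blast
  have "\<exists>a\<ge>L - 1 / \<epsilon>. a \<le> L + 1 / \<epsilon> \<and> f a 1 = q"
  proof (rule IVT'[OF _ _ _ cont1])
    show "f (L - 1 / \<epsilon>) 1 \<le> q" "q \<le> f (L + 1 / \<epsilon>) 1"
      using el_solution_increment[OF \<epsilon> sol[of "L - 1 / \<epsilon>"] R] el_solution_increment[OF \<epsilon> sol[of "L + 1 / \<epsilon>"] R] \<epsilon>
      by (simp_all add: L)
  qed (use \<epsilon> in simp)
  then show ?thesis using sol by blast
qed

section \<open>Uniqueness\<close>

text \<open>A feedback estimate on \<open>N\<close>, the maximum of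
  \<open>\<bar>u - z\<bar>\<close>: it bounds the slope of \<open>g - f\<close>, hence
  \<open>g - f\<close> itself, hence the slope of \<open>u - z\<close>. With total gain
  \<open>\<kappa>\<close> below 1/2, the difference \<open>u - z\<close> cannot fall from
  \<open>b - a\<close> to 0.\<close>

lemma no_crossing_if_small:
  assumes \<epsilon>: "0 < \<epsilon>" and f: "el_solution \<epsilon> R p a f z" "f 1 = q" and g: "el_solution \<epsilon> R p b g u" "g 1 = q"
    and R: "\<And>x. x \<in> {0..1} \<Longrightarrow> 0 \<le> R x \<and> R x \<le> x"
    and small: "exp (2 / \<epsilon>) * min (\<epsilon> * (q - p)) (1 - \<epsilon> * (q - p)) < 2 * \<epsilon>\<^sup>2"
  shows "\<not> a < b"
proof
  assume ab: "a < b"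
  define c where "c = exp (2 / \<epsilon>) * min (\<epsilon> * (q - p)) (1 - \<epsilon> * (q - p))"
  \<comment> \<open>The gain of the feedback loop; the bound \<open>2 * \<epsilon>\<^sup>2\<close>
    in the hypothesis is precisely \<open>\<kappa> < 1/2\<close>.\<close>
  define \<kappa> where "\<kappa> = c / (4 * \<epsilon>\<^sup>2)"
  have \<kappa>: "\<kappa> < 1/2" using small \<epsilon> by (simp add: \<kappa>_def c_def field_simps)
  \<comment> \<open>The drift bound is spent twice, once to reach \<open>d\<close> and once to reach
    \<open>d - 1 / \<epsilon>\<close>, where the increment estimate applies; this shift by
    \<open>2 / \<epsilon>\<close> costs the factor \<open>exp (2 / \<epsilon>)\<close>. The
    complement is treated by reflection.\<close>
  have range: "logistic (h x - R x / \<epsilon>) \<le> exp (2 / \<epsilon>) * (\<epsilon> * (q - p)) \<and>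
      1 - logistic (h x - R x / \<epsilon>) \<le> exp (2 / \<epsilon>) * (1 - \<epsilon> * (q - p))"
    if h: "el_solution \<epsilon> R p d k h" "k 1 = q" and x: "x \<in> {0..1}" for d k h x
  proof -
    have dr: "\<bar>h x - R x / \<epsilon> - d\<bar> \<le> 1 / \<epsilon>"
      using R[OF x] by (intro el_solution_drift[OF \<epsilon> h(1) x]) auto
    have inc: "logistic (d - 1 / \<epsilon>) \<le> \<epsilon> * (q - p)" "logistic (- d - 1 / \<epsilon>) \<le> 1 - \<epsilon> * (q - p)"
      using el_solution_increment[OF \<epsilon> h(1) R] h(2) logistic_minus[of "d + 1 / \<epsilon>"] by auto
    have two: "2 / \<epsilon> = 1 / \<epsilon> + 1 / \<epsilon>" by simp
    have "logistic (h x - R x / \<epsilon>) \<le> logistic (d - 1 / \<epsilon> + 2 / \<epsilon>)"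
      using dr two unfolding logistic_le_iff by linarith
    also have "\<dots> \<le> exp (2 / \<epsilon>) * logistic (d - 1 / \<epsilon>)" using \<epsilon> by (intro logistic_add_le) simp
    also have "\<dots> \<le> exp (2 / \<epsilon>) * (\<epsilon> * (q - p))" using inc(1) by (intro mult_left_mono) auto
    finally have 1: "logistic (h x - R x / \<epsilon>) \<le> exp (2 / \<epsilon>) * (\<epsilon> * (q - p))" .
    have "logistic (- (h x - R x / \<epsilon>)) \<le> logistic (- d - 1 / \<epsilon> + 2 / \<epsilon>)"
      using dr two unfolding logistic_le_iff by linarith
    also have "\<dots> \<le> exp (2 / \<epsilon>) * logistic (- d - 1 / \<epsilon>)" using \<epsilon> by (intro logistic_add_le) simp
    also have "\<dots> \<le> exp (2 / \<epsilon>) * (1 - \<epsilon> * (q - p))" using inc(2) by (intro mult_left_mono) auto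
    finally show ?thesis using 1 unfolding logistic_minus by simp
  qed
  note F = el_solutionD[OF f(1)] and G = el_solutionD[OF g(1)]
  \<comment> \<open>The term \<open>R x / \<epsilon>\<close> cancels, so \<open>E\<close> is also
    the difference of the arguments of \<open>logistic\<close>.\<close>
  define D E where "D x = g x - f x" and "E x = u x - z x" for x
  define D' where "D' x = logistic (u x - R x / \<epsilon>) / \<epsilon> - logistic (z x - R x / \<epsilon>) / \<epsilon>" for x
  define E' where "E' x = logistic (- g x) / \<epsilon> - logistic (- f x) / \<epsilon>" for x
  have D: "(D has_real_derivative D' t) (at t within {0..1})" if "t \<in> {0..1}" for t
    unfolding D_def[abs_def] D'_def using G(3)[OF that] F(3)[OF that] by (rule DERIV_diff)
  have E: "(E has_real_derivative E' t) (at t within {0..1})" if "t \<in> {0..1}" for t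
    unfolding E_def[abs_def] E'_def using G(4)[OF that] F(4)[OF that] by (rule DERIV_diff)
  have "continuous_on {0..1} (\<lambda>x. \<bar>E x\<bar>)"
    using DERIV_continuous_on[OF E] by (intro continuous_intros)
  then obtain x0 where x0: "x0 \<in> {0..1}" "\<And>x. x \<in> {0..1} \<Longrightarrow> \<bar>E x\<bar> \<le> \<bar>E x0\<bar>"
    using continuous_attains_sup[of "{0..1::real}" "\<lambda>x. \<bar>E x\<bar>"] by auto
  define N where "N = \<bar>E x0\<bar>"
  have "logistic (a - 1 / \<epsilon>) \<le> \<epsilon> * (q - p)" "\<epsilon> * (q - p) \<le> logistic (a + 1 / \<epsilon>)"
    using el_solution_increment[OF \<epsilon> f(1) R] f(2) by auto
  then have "0 \<le> \<epsilon> * (q - p)" "\<epsilon> * (q - p) \<le> 1"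
    using logistic_pos[of "a - 1 / \<epsilon>"] logistic_less_1[of "a + 1 / \<epsilon>"] by linarith+
  then have c0: "0 \<le> c" by (simp add: c_def)
  have D'_le: "\<bar>D' t\<bar> \<le> c * N / \<epsilon>" if "t \<in> {0..1}" for t
  proof -
    have "\<bar>logistic (u t - R t / \<epsilon>) - logistic (z t - R t / \<epsilon>)\<bar> \<le> c * \<bar>(u t - R t / \<epsilon>) - (z t - R t / \<epsilon>)\<bar>"
    proof (cases "\<epsilon> * (q - p) \<le> 1 - \<epsilon> * (q - p)")
      case True
      then show ?thesis unfolding c_def min_def if_P[OF True]
        using range[OF f that] range[OF g that] by (intro logistic_diff_le) auto
    next
      case False
      then show ?thesis unfolding c_def min_def if_not_P[OF False]
        using range[OF f that] range[OF g that] by (intro logistic_diff_le_compl) auto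
    qed
    also have "\<dots> \<le> c * N" using x0(2)[OF that] c0 by (intro mult_left_mono) (auto simp: E_def N_def)
    finally show ?thesis using \<epsilon>
      by (simp add: D'_def divide_right_mono flip: diff_divide_distrib)
  qed
  have D_le: "\<bar>D t\<bar> \<le> c * N / \<epsilon>" if t: "t \<in> {0..1}" for t
  proof -
    have "norm (D t - D 0) \<le> c * N / \<epsilon> * norm (t - 0)"
      by (rule field_differentiable_bound[OF _ D]) (use D'_le t in auto)
    also have "\<dots> \<le> c * N / \<epsilon>" using t c0 \<epsilon> by (intro mult_right_le_one_le) (auto simp: N_def)
    finally show ?thesis using F G by (simp add: D_def)
  qed
  have E'_le: "\<bar>E' t\<bar> \<le> \<kappa> * N" if "t \<in> {0..1}" for t
  proof -
    have "\<bar>E' t\<bar> \<le> \<bar>D t\<bar> / (4 * \<epsilon>)"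
      using logistic_diff_divide_le[OF \<epsilon>, of "- g t" "- f t"] by (simp add: E'_def D_def abs_minus_commute)
    also have "\<dots> \<le> (c * N / \<epsilon>) / (4 * \<epsilon>)" using D_le[OF that] \<epsilon> by (intro divide_right_mono) auto
    finally show ?thesis by (simp add: \<kappa>_def power2_eq_square field_simps)
  qed
  have E0: "E 0 = b - a" using F G by (simp add: E_def)
  have \<kappa>N: "0 \<le> \<kappa> * N" using c0 by (simp add: \<kappa>_def N_def)
  have E_near: "\<bar>E t - (b - a)\<bar> \<le> \<kappa> * N" if t: "t \<in> {0..1}" for t
  proof -
    have "norm (E t - E 0) \<le> \<kappa> * N * norm (t - 0)"
      by (rule field_differentiable_bound[OF _ E]) (use E'_le t in auto)
    also have "\<dots> \<le> \<kappa> * N" using t \<kappa>N by (intro mult_right_le_one_le) auto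
    finally show ?thesis by (simp add: E0)
  qed
  have "N \<le> (b - a) + \<kappa> * N" using E_near[OF x0(1)] ab by (simp add: N_def)
  \<comment> \<open>From \<open>N \<le> (b - a) + \<kappa> * N\<close> and
    \<open>\<kappa> < 1/2\<close> one gets
    \<open>\<kappa> * N < N / 2 < N - \<kappa> * N \<le> b - a\<close> when \<open>N\<close> is
    positive.\<close>
  moreover have "\<kappa> * N < b - a"
  proof (cases "N = 0")
    case False
    then have "\<kappa> * N < 1/2 * N" using \<kappa> by (intro mult_strict_right_mono) (auto simp: N_def)
    then show ?thesis using \<open>N \<le> (b - a) + \<kappa> * N\<close> by linarith
  qed (use ab in simp)
  ultimately have "E t > 0" if "t \<in> {0..1}" for t using E_near[OF that] by linarith
  then have D'_pos: "D' t > 0" if "t \<in> {0..1}" for t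
    using that \<epsilon> by (simp add: D'_def E_def divide_strict_right_mono)
  obtain t :: real where "t \<in> {0<..<1}" "D 1 - D 0 = D' t * (1 - 0)"
    using MVT_within[of 0 1 "{0..1}" D, OF _ _ D] by auto
  then show False using D'_pos[of t] F G f(2) g(2) by (auto simp: D_def)
qed

text \<open>While \<open>g\<close> lies above \<open>f\<close>, monotonicity of \<open>r\<close>
  keeps the energy difference \<open>J\<close> from decreasing; at the zeros of \<open>g - f\<close>
  this difference determines which of the two slopes is larger.\<close>

lemma no_crossing_if_mono:
  assumes \<epsilon>: "0 < \<epsilon>" and f: "el_solution \<epsilon> R p a f z" "f 1 = q" and g: "el_solution \<epsilon> R p b g u" "g 1 = q"
    and R0: "R 0 = 0"
    and R: "\<And>x. x \<in> {0..1} \<Longrightarrow> (R has_real_derivative r x) (at x within {0..1})"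
    and r: "\<And>x. x \<in> {0..1} \<Longrightarrow> (r has_real_derivative r' x) (at x within {0..1})"
    and mono: "mono_on {0..1} r"
  shows "\<not> a < b"
proof
  assume ab: "a < b"
  note F = el_solutionD[OF f(1)] and G = el_solutionD[OF g(1)]
  \<comment> \<open>Here \<open>v\<close> belongs to \<open>f\<close> and \<open>w\<close> to
    \<open>g\<close>, the reverse of the letters in the idea of the proof.\<close>
  define v w where "v x = z x - R x / \<epsilon>" and "w x = u x - R x / \<epsilon>" for x
  define D where "D x = g x - f x" for x
  have D: "(D has_real_derivative (logistic (w x) / \<epsilon> - logistic (v x) / \<epsilon>)) (at x within {0..1})"
    if "x \<in> {0..1}" for x
    unfolding D_def[abs_def] v_def w_def using G(3)[OF that] F(3)[OF that] by (rule DERIV_diff)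
  have cont: "continuous_on {0..1} D" by (rule DERIV_continuous_on[OF D])
  have D01: "D 0 = 0" "D 1 = 0" using F G f g by (auto simp: D_def)
  have "v 0 < w 0" using F G ab R0 by (simp add: v_def w_def)
  then have "0 < logistic (w 0) / \<epsilon> - logistic (v 0) / \<epsilon>" using \<epsilon> by (simp add: divide_strict_right_mono)
  from has_real_derivative_pos_inc_right[OF D this] obtain d
    where d: "d > 0" "\<And>h. h > 0 \<Longrightarrow> h \<in> {0..1} \<Longrightarrow> h < d \<Longrightarrow> D h > 0"
    using D01 by auto
  \<comment> \<open>The zero of \<open>D\<close> at 0 is cut off: \<open>D\<close> is positive on
    \<open>{0<..m}\<close>, so the infimum of \<open>Z\<close> is the first zero after 0.\<close>
  define m where "m = min (d / 2) (1 / 2)"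
  have m: "0 < m" "m < d" "m < 1" using d by (auto simp: m_def)
  define Z where "Z = {x \<in> {m..1}. D x = 0}"
  have "closed Z" unfolding Z_def
    by (rule continuous_closed_preimage_constant[OF continuous_on_subset[OF cont]]) (use m in auto)
  moreover have Zne: "Z \<noteq> {}" "bdd_below Z"
    using m D01 by (auto simp: Z_def intro: bdd_belowI[of _ m])
  ultimately have x1Z: "Inf Z \<in> Z" by (intro closed_contains_Inf)
  define x1 where "x1 = Inf Z"
  have x1: "m \<le> x1" "x1 \<le> 1" "D x1 = 0" using x1Z by (auto simp: Z_def x1_def)
  have Dm: "D m > 0" using d m by auto
  have D_pos: "D x > 0" if x: "0 < x" "x < x1" for x
  proof (cases "x \<le> m")
    case True then show ?thesis using d m x by auto
  next
    case False
    show ?thesis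
    proof (rule ccontr)
      assume "\<not> D x > 0"
      then have "\<exists>y\<ge>m. y \<le> x \<and> D y = 0"
        using Dm False x x1 m by (intro IVT2' continuous_on_subset[OF cont]) auto
      then obtain y where "y \<in> Z" "y \<le> x" using x x1 by (auto simp: Z_def)
      then show False using x cInf_lower[OF \<open>y \<in> Z\<close> Zne(2)] by (simp add: x1_def)
    qed
  qed
  \<comment> \<open>For constant \<open>r\<close>, the quantity
    \<open>softplus (w x) + softplus (- g x) + r * g x\<close> is a first integral of the system.
    \<open>J\<close> is the difference of these energies for the two solutions, so only
    \<open>r' x * D x\<close> survives in its derivative.\<close>
  define J where "J x = softplus (w x) - softplus (v x) + softplus (- g x) - softplus (- f x) + r x * D x" for x
  have J: "(J has_real_derivative r' x * D x) (at x within {0..1})" if x: "x \<in> {0..1}" for x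
  proof -
    have v: "(v has_real_derivative (logistic (- f x) - r x) / \<epsilon>) (at x within {0..1})"
      unfolding v_def[abs_def] using F(4)[OF x] R[OF x] \<epsilon>
      by (auto intro!: derivative_eq_intros simp: field_simps)
    have w: "(w has_real_derivative (logistic (- g x) - r x) / \<epsilon>) (at x within {0..1})"
      unfolding w_def[abs_def] using G(4)[OF x] R[OF x] \<epsilon>
      by (auto intro!: derivative_eq_intros simp: field_simps)
    show ?thesis
      unfolding J_def[abs_def]
      by (rule DERIV_cong, (rule derivative_intros v w F(3)[OF x, folded v_def] G(3)[OF x, folded w_def] D[OF x] r[OF x])+)
        (simp add: algebra_simps diff_divide_distrib)
  qed
  have "x1 > 0" using x1 m by simp
  then have "\<exists>t\<in>{0<..<x1}. J x1 - J 0 = r' t * D t * (x1 - 0)"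
    by (rule MVT_within[OF _ _ J]) (use x1 in auto)
  then obtain t where t: "t \<in> {0<..<x1}" "J x1 - J 0 = r' t * D t * (x1 - 0)" by blast
  \<comment> \<open>In the interior the one-sided derivative is two-sided, and a monotone function
    has nonnegative derivative there.\<close>
  have "t \<in> interior {0..1}" using t x1 by simp
  moreover from this have "(r has_real_derivative r' t) (at t)"
    using r[of t] t x1 at_within_interior[of t "{0..1}"] by auto
  ultimately have "r' t \<ge> 0" using mono_on_imp_deriv_nonneg[OF mono] by blast
  then have "0 \<le> r' t * D t * (x1 - 0)" using t D_pos[of t] x1 by simp
  then have "J x1 \<ge> J 0" using t by linarith
  moreover have "J 0 > 0" using \<open>v 0 < w 0\<close> F(1) G(1) by (simp add: J_def D01)
  moreover have "J x1 = softplus (w x1) - softplus (v x1)" using x1 by (simp add: J_def D_def)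
  ultimately have "softplus (v x1) < softplus (w x1)" by linarith
  then have "v x1 < w x1" by simp
  then have "0 < logistic (w x1) / \<epsilon> - logistic (v x1) / \<epsilon>" using \<epsilon> by (simp add: divide_strict_right_mono)
  \<comment> \<open>A positive slope at the zero \<open>x1\<close> makes \<open>D\<close> negative
    just to its left, against \<open>D_pos\<close>.\<close>
  from has_real_derivative_pos_inc_left[OF D this] x1 \<open>x1 > 0\<close> obtain e
    where e: "e > 0" "\<And>h. h > 0 \<Longrightarrow> x1 - h \<in> {0..1} \<Longrightarrow> h < e \<Longrightarrow> D (x1 - h) < 0"
    by auto
  define h where "h = min (e / 2) (x1 / 2)"
  have "h > 0" "h < e" "h < x1" using e \<open>x1 > 0\<close> by (auto simp: h_def)
  then show False using e(2)[of h] D_pos[of "x1 - h"] x1 by auto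
qed

section \<open>Fixed points as solutions\<close>

lemma FTC_within:
  fixes f :: "real \<Rightarrow> real"
  assumes "a \<le> x" "{a..x} \<subseteq> S"
    and "\<And>t. t \<in> S \<Longrightarrow> (f has_real_derivative f' t) (at t within S)"
  shows "(f' has_integral (f x - f a)) {a..x}"
proof (rule fundamental_theorem_of_calculus[OF \<open>a \<le> x\<close>])
  fix t assume "t \<in> {a..x}"
  then have "(f has_real_derivative f' t) (at t within {a..x})"
    using assms by (intro has_field_derivative_subset[OF assms(3)]) auto
  then show "(f has_vector_derivative f' t) (at t within {a..x})"
    by (simp add: has_real_derivative_iff_has_vector_derivative)
qed

section \<open>Densities, potentials and measurability\<close>

lemma density_space_integrable:
  assumes "\<rho> \<in> density_space"
  shows "set_integrable lebesgue {0..1} \<rho>"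
proof -
  interpret finite_measure "lebesgue_on {0..1::real}"
    by (rule finite_measure_lebesgue_on) simp
  have "integrable (lebesgue_on {0..1}) \<rho>"
    using assms by (intro integrable_const_bound[where B = 1]) (auto simp: density_space_def)
  then show ?thesis by (simp add: set_integrable_def integrable_restrict_space)
qed

lemma set_integrable_unit_subinterval:
  fixes h :: "real \<Rightarrow> real"
  assumes "set_integrable lebesgue {0..1} h" "x \<in> {0..1}"
  shows "set_integrable lebesgue {0..x} h"
  by (rule set_integrable_subset[OF assms(1)]) (use assms(2) in auto)

lemma density_space_primitive_bounds:
  assumes \<rho>: "\<rho> \<in> density_space" and x: "x \<in> {0..1}"
  shows "0 \<le> integral {0..x} \<rho> \<and> integral {0..x} \<rho> \<le> x"
proof -
  have int: "set_integrable lebesgue {0..x} \<rho>"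
    using density_space_integrable[OF \<rho>] x by (rule set_integrable_unit_subinterval)
  \<comment> \<open>The gauge integral is rewritten as a Lebesgue integral, for which the
    almost-everywhere bounds on \<open>\<rho>\<close> can be applied.\<close>
  have eq: "integral {0..x} \<rho> = (\<integral>z. indicator {0..x} z * \<rho> z \<partial>lebesgue)"
    using set_lebesgue_integral_eq_integral(2)[OF int] by (simp add: set_lebesgue_integral_def)
  have "AE z in lebesgue_on {0..1}. 0 \<le> \<rho> z \<and> \<rho> z \<le> 1"
    using \<rho> unfolding density_space_def by blast
  then have ae: "AE z in lebesgue. z \<in> {0..1} \<longrightarrow> 0 \<le> \<rho> z \<and> \<rho> z \<le> 1"
    by (rule AE_restrict_space_iff[THEN iffD1, rotated]) simp
  have "0 \<le> (\<integral>z. indicator {0..x} z * \<rho> z \<partial>lebesgue)"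
    using ae x by (intro integral_nonneg_AE) (auto elim!: eventually_mono simp: indicator_def)
  moreover have "(\<integral>z. indicator {0..x} z * \<rho> z \<partial>lebesgue) \<le> (\<integral>z. indicator {0..x} z \<partial>lebesgue)"
  proof (rule integral_mono_AE)
    show "integrable lebesgue (\<lambda>z. indicator {0..x} z * \<rho> z)"
      using int by (simp add: set_integrable_def)
    show "AE z in lebesgue. indicator {0..x} z * \<rho> z \<le> indicator {0..x} z"
      using ae x by (auto elim!: eventually_mono simp: indicator_def)
    show "integrable lebesgue (indicat_real {0..x})"
      by (rule integrable_real_indicator) (use x in auto)
  qed
  moreover have "(\<integral>z. indicator {0..x} z \<partial>lebesgue) = x" using x by simp
  ultimately show ?thesis using eq by simp
qed

text \<open>A finite measure is monotone on the intervals \<open>{0..x}\<close>. Monotonicity will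
  provide measurability of the integrand in \<open>exp_weight\<close>.\<close>

lemma potential_space_mono:
  assumes "\<phi> \<in> potential_space \<phi>0 \<phi>1"
  shows "mono_on {0..1} \<phi>"
proof -
  obtain \<mu> where \<mu>: "sets \<mu> = sets (restrict_space borel {0..1::real})"
    "emeasure \<mu> {0..1} = ennreal (\<phi>1 - \<phi>0)" "\<phi> = (\<lambda>x\<in>{0..1}. \<phi>0 + measure \<mu> {0..x})"
    using assms unfolding potential_space_def by blast
  have "space \<mu> = {0..1}" using sets_eq_imp_space_eq[OF \<mu>(1)] by (simp add: space_restrict_space)
  then interpret finite_measure \<mu> using \<mu>(2) by (intro finite_measureI) simp
  have meas: "{0..y} \<in> sets \<mu>" if "y \<in> {0..1}" for y
    unfolding \<mu>(1) sets_restrict_space using that by (intro image_eqI[of _ _ "{0..y}"]) auto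
  show ?thesis
    by (rule mono_onI) (auto simp: \<mu>(3) intro!: finite_measure_mono meas)
qed

text \<open>The required measure has density \<open>f'\<close>; the fundamental theorem of calculus
  computes its mass on \<open>{0..x}\<close>.\<close>

lemma potential_spaceI:
  assumes f: "\<And>x. x \<in> {0..1} \<Longrightarrow> (f has_real_derivative f' x) (at x within {0..1})"
    and cont: "continuous_on {0..1} f'" and nonneg: "\<And>x. x \<in> {0..1} \<Longrightarrow> 0 \<le> f' x"
    and ends: "f 0 = \<phi>0" "f 1 = \<phi>1"
  shows "restrict f {0..1} \<in> potential_space \<phi>0 \<phi>1"
proof -
  \<comment> \<open>Extension by 0 makes the derivative Borel measurable on the whole line.\<close>
  define g where "g x = (if x \<in> {0..1} then f' x else 0)" for x :: real
  have g[measurable]: "g \<in> borel_measurable borel"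
    unfolding g_def by (rule borel_measurable_continuous_on_if[OF _ cont]) auto
  define \<mu> where "\<mu> = density (restrict_space lborel {0..1::real}) (\<lambda>x. ennreal (g x))"
  have sets: "sets \<mu> = sets (restrict_space borel {0..1})"
    unfolding \<mu>_def sets_density by (rule sets_restrict_space_cong) simp
  have mu: "emeasure \<mu> {0..x} = ennreal (f x - \<phi>0) \<and> 0 \<le> f x - \<phi>0" if x: "x \<in> {0..1}" for x
  proof -
    have "{0..x} \<in> sets (restrict_space lborel {0..1::real})"
      unfolding sets_restrict_space using x by (intro image_eqI[of _ _ "{0..x}"]) auto
    then have "emeasure \<mu> {0..x} = (\<integral>\<^sup>+y. ennreal (g y) * indicator {0..x} y \<partial>restrict_space lborel {0..1})"
      unfolding \<mu>_def by (intro emeasure_density measurable_restrict_space1) auto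
    also have "\<dots> = (\<integral>\<^sup>+y. ennreal (g y * indicator {0..x} y) \<partial>lborel)"
      using x by (subst nn_integral_restrict_space) (auto intro!: nn_integral_cong split: split_indicator)
    finally have eq: "emeasure \<mu> {0..x} = (\<integral>\<^sup>+y. ennreal (g y * indicator {0..x} y) \<partial>lborel)" .
    have "(f' has_integral (f x - f 0)) {0..x}"
      using x by (intro FTC_within[OF _ _ f]) auto
    then have "((\<lambda>y. if y \<in> {0..x} then f' y else 0) has_integral (f x - f 0)) UNIV"
      by (simp only: has_integral_restrict_UNIV)
    also have "(\<lambda>y. if y \<in> {0..x} then f' y else 0) = (\<lambda>y. g y * indicator {0..x} y)"
      using x by (auto simp: g_def fun_eq_iff)
    finally have hi: "((\<lambda>y. g y * indicator {0..x} y) has_integral (f x - f 0)) UNIV" .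
    have nn: "0 \<le> g y * indicator {0..x} y" for y using nonneg by (simp add: g_def split: split_indicator)
    have "(\<integral>\<^sup>+y. ennreal (g y * indicator {0..x} y) \<partial>lborel) = ennreal (f x - f 0)"
      by (rule nn_integral_has_integral_lborel[OF _ nn hi]) measurable
    moreover have "0 \<le> f x - f 0" using has_integral_nonneg[OF hi] nn by simp
    ultimately show ?thesis using eq ends by simp
  qed
  have "restrict f {0..1} = (\<lambda>x\<in>{0..1}. \<phi>0 + measure \<mu> {0..x})"
    using mu by (auto simp: fun_eq_iff restrict_def measure_def)
  then show ?thesis using sets mu[of 1] ends by (auto simp: potential_space_def)
qed

text \<open>The function is antitone, hence Borel, and it is bounded by 1.\<close>

lemma set_integrable_logistic_mono:
  fixes \<phi> :: "real \<Rightarrow> real"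
  assumes "mono_on {0..1} \<phi>"
  shows "set_integrable lebesgue {0..1} (\<lambda>z. logistic (- \<phi> z))"
proof -
  interpret finite_measure "lebesgue_on {0..1::real}"
    by (rule finite_measure_lebesgue_on) simp
  have "mono_on {0..1} (\<lambda>z. - logistic (- \<phi> z))"
    using assms by (auto simp: mono_on_def)
  then have "(\<lambda>z. - logistic (- \<phi> z)) \<in> borel_measurable (restrict_space borel {0..1})"
    by (rule borel_measurable_mono_on_fnc)
  then have "(\<lambda>z. - (- logistic (- \<phi> z))) \<in> borel_measurable (restrict_space borel {0..1})"
    by (rule borel_measurable_uminus)
  then have "(\<lambda>z. logistic (- \<phi> z)) \<in> borel_measurable (lebesgue_on {0..1})"
    by (simp add: borel_measurable_restrict_space_iff measurable_completion)
  then have "integrable (lebesgue_on {0..1}) (\<lambda>z. logistic (- \<phi> z))"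
    by (intro integrable_const_bound[where B = 1]) (auto simp: less_imp_le)
  then show ?thesis by (simp add: set_integrable_def integrable_restrict_space)
qed

section \<open>The normalising constant and the operator\<close>

text \<open>Determines \<open>a = ln A\<close>: the integral is strictly increasing and Lipschitz in
  \<open>a\<close>, and it passes through \<open>c\<close>.\<close>

lemma logistic_flux_ex1:
  fixes W :: "real \<Rightarrow> real"
  assumes W: "continuous_on {0..1} W" and c: "0 < c" "c < 1"
  shows "\<exists>!a. integral {0..1} (\<lambda>y. logistic (a + W y)) = c"
proof -
  define I where "I a x = integral {0..x} (\<lambda>y. logistic (a + W y))" for a x :: real
  have I: "(I a has_real_derivative logistic (a + W x)) (at x within {0..1})" if "x \<in> {0..1}" for a x
    unfolding I_def[abs_def] using that W
    by (intro integral_has_real_derivative[where g = "\<lambda>y. logistic (a + W y)"] continuous_intros) auto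
  have I0: "I a 0 = 0" for a by (simp add: I_def)
  have mean: "\<exists>t\<in>{0<..<1}. I a 1 = logistic (a + W t)" for a
    using MVT_within[of 0 1 "{0..1}" "I a", OF _ _ I] I0 by auto
  \<comment> \<open>The mean value theorem for the difference of the primitives evaluates both
    integrands at the same point, which yields strict monotonicity and the Lipschitz bound
    together.\<close>
  have diff: "\<exists>t\<in>{0<..<1}. I b 1 - I a 1 = logistic (b + W t) - logistic (a + W t)" for a b
    using MVT_within[of 0 1 "{0..1}" "\<lambda>x. I b x - I a x", OF _ _ DERIV_diff[OF I I]] I0 by auto
  have strict: "I a 1 < I b 1" if ab: "a < b" for a b
  proof -
    obtain t where "I b 1 - I a 1 = logistic (b + W t) - logistic (a + W t)" using diff by blast
    moreover have "logistic (a + W t) < logistic (b + W t)" using ab by simp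
    ultimately show ?thesis by linarith
  qed
  have "1-lipschitz_on UNIV (\<lambda>a. I a 1)"
  proof (rule lipschitz_onI)
    fix a b :: real
    obtain t where "I a 1 - I b 1 = logistic (a + W t) - logistic (b + W t)" using diff by blast
    then have "\<bar>I a 1 - I b 1\<bar> \<le> \<bar>a - b\<bar> / 4"
      using logistic_Lipschitz[of "a + W t" "b + W t"] by simp
    also have "\<dots> \<le> 1 * \<bar>a - b\<bar>" by simp
    finally show "dist (I a 1) (I b 1) \<le> 1 * dist a b" unfolding dist_real_def .
  qed simp
  then have cont: "continuous_on S (\<lambda>a. I a 1)" for S
    using lipschitz_on_continuous_on continuous_on_subset by blast
  have "\<exists>x0\<in>{0..1}. \<forall>x\<in>{0..1}. \<bar>W x\<bar> \<le> \<bar>W x0\<bar>"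
    using W by (intro continuous_attains_sup continuous_intros) auto
  then obtain x0 where x0: "\<And>x. x \<in> {0..1} \<Longrightarrow> \<bar>W x\<bar> \<le> \<bar>W x0\<bar>" by blast
  \<comment> \<open>Since \<open>logistic L = c\<close>, moving \<open>a\<close> from
    \<open>L\<close> by the maximum of \<open>\<bar>W\<bar>\<close> puts the integrand on the
    desired side of \<open>c\<close> everywhere.\<close>
  define L where "L = ln (c / (1 - c))"
  have L: "logistic L = c" using c unfolding L_def by (intro logistic_ln) auto
  have "I (L - \<bar>W x0\<bar>) 1 \<le> c" "c \<le> I (L + \<bar>W x0\<bar>) 1"
  proof -
    obtain t where t: "t \<in> {0<..<1}" "I (L - \<bar>W x0\<bar>) 1 = logistic (L - \<bar>W x0\<bar> + W t)" using mean by blast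
    show "I (L - \<bar>W x0\<bar>) 1 \<le> c" using x0[of t] t(1) unfolding t(2) L[symmetric] logistic_le_iff by auto
    obtain s where s: "s \<in> {0<..<1}" "I (L + \<bar>W x0\<bar>) 1 = logistic (L + \<bar>W x0\<bar> + W s)" using mean by blast
    show "c \<le> I (L + \<bar>W x0\<bar>) 1" using x0[of s] s(1) unfolding s(2) L[symmetric] logistic_le_iff by auto
  qed
  then obtain a where a: "I a 1 = c"
    using IVT'[of "\<lambda>a. I a 1" "L - \<bar>W x0\<bar>" c "L + \<bar>W x0\<bar>"] cont by auto
  show ?thesis
  proof (rule ex1I[of _ a])
    fix b assume "integral {0..1} (\<lambda>y. logistic (b + W y)) = c"
    then have "I b 1 = c" by (simp add: I_def)
    then show "b = a" using a strict[of a b] strict[of b a] by (cases a b rule: linorder_cases) auto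
  qed (use a in \<open>simp add: I_def\<close>)
qed

text \<open>The logarithm of \<open>exp_weight\<close> on the unit interval for admissible data,
  split into two gauge integrals that can be handled separately.\<close>

definition log_weight :: "(real \<Rightarrow> real) \<Rightarrow> real \<Rightarrow> (real \<Rightarrow> real) \<Rightarrow> real \<Rightarrow> real" where
  "log_weight \<rho> \<epsilon> \<phi> y = (integral {0..y} (\<lambda>z. logistic (- \<phi> z)) - integral {0..y} \<rho>) / \<epsilon>"

lemma log_weight_continuous:
  assumes "\<rho> \<in> density_space" "set_integrable lebesgue {0..1} (\<lambda>z. logistic (- \<phi> z))" "0 < \<epsilon>"
  shows "continuous_on {0..1} (log_weight \<rho> \<epsilon> \<phi>)"
  unfolding log_weight_def[abs_def]
  using set_lebesgue_integral_eq_integral(1)[OF assms(2)] assms(3)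
    set_lebesgue_integral_eq_integral(1)[OF density_space_integrable[OF assms(1)]]
  by (intro continuous_intros indefinite_integral_continuous_1) auto

text \<open>With \<open>A = exp a\<close> the fraction in \<open>K_with\<close> is
  \<open>logistic\<close> of \<open>a\<close> plus the logarithm of the weight.\<close>

lemma K_with_exp:
  assumes \<rho>: "\<rho> \<in> density_space" and \<phi>: "set_integrable lebesgue {0..1} (\<lambda>z. logistic (- \<phi> z))"
    and \<epsilon>: "0 < \<epsilon>" and x: "x \<in> {0..1}"
  shows "K_with \<phi>0 \<rho> \<epsilon> \<phi> (exp a) x = \<phi>0 + integral {0..x} (\<lambda>y. logistic (a + log_weight \<rho> \<epsilon> \<phi> y)) / \<epsilon>"
proof -
  have w: "exp_weight \<rho> \<epsilon> \<phi> y = exp (log_weight \<rho> \<epsilon> \<phi> y)" if "y \<in> {0..1}" for y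
    using set_integrable_unit_subinterval[OF density_space_integrable[OF \<rho>] that]
      set_integrable_unit_subinterval[OF \<phi> that]
    by (simp add: exp_weight_def log_weight_def inverse_one_plus_exp set_lebesgue_integral_eq_integral)
  have "(LINT y:{0..x}|lebesgue. exp a * exp_weight \<rho> \<epsilon> \<phi> y / (1 + exp a * exp_weight \<rho> \<epsilon> \<phi> y))
      = (LINT y:{0..x}|lebesgue. logistic (a + log_weight \<rho> \<epsilon> \<phi> y))"
    using x by (intro set_lebesgue_integral_cong) (auto simp: w logistic_def exp_add)
  also have "\<dots> = integral {0..x} (\<lambda>y. logistic (a + log_weight \<rho> \<epsilon> \<phi> y))"
    using x by (intro set_lebesgue_integral_eq_integral(2) absolutely_integrable_continuous_real continuous_intros
        continuous_on_subset[OF log_weight_continuous[OF \<rho> \<phi> \<epsilon>]]) auto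
  finally show ?thesis by (simp add: K_with_def)
qed

text \<open>The exponential maps the reals bijectively onto the positive reals, so unique existence
  carries over from \<open>a\<close> to \<open>A\<close>.\<close>

lemma A_const_ex1:
  assumes \<rho>: "\<rho> \<in> density_space" and \<phi>: "set_integrable lebesgue {0..1} (\<lambda>z. logistic (- \<phi> z))"
    and \<epsilon>: "0 < \<epsilon>" and pq: "\<phi>0 < \<phi>1" "\<epsilon> * (\<phi>1 - \<phi>0) < 1"
  shows "\<exists>!A. 0 < A \<and> K_with \<phi>0 \<rho> \<epsilon> \<phi> A 1 = \<phi>1"
proof -
  have *: "K_with \<phi>0 \<rho> \<epsilon> \<phi> (exp a) 1 = \<phi>1 \<longleftrightarrow>
      integral {0..1} (\<lambda>y. logistic (a + log_weight \<rho> \<epsilon> \<phi> y)) = \<epsilon> * (\<phi>1 - \<phi>0)" for a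
    using K_with_exp[OF \<rho> \<phi> \<epsilon>, of 1 \<phi>0 a] \<epsilon> by (auto simp: field_simps)
  have "\<exists>!a. K_with \<phi>0 \<rho> \<epsilon> \<phi> (exp a) 1 = \<phi>1"
    unfolding * using \<epsilon> pq by (intro logistic_flux_ex1 log_weight_continuous \<rho> \<phi>) auto
  then show ?thesis by (metis exp_gt_zero exp_ln)
qed

text \<open>A bootstrap: \<open>\<phi>\<close> is at first only monotone, but as an image of the
  operator it is differentiable, and its continuity then makes the primitive of
  \<open>logistic (- \<phi> y)\<close> differentiable everywhere.\<close>

lemma fixed_point_imp_el_solution:
  assumes \<rho>: "\<rho> \<in> density_space" and \<epsilon>: "0 < \<epsilon>" and pq: "\<phi>0 < \<phi>1" "\<epsilon> * (\<phi>1 - \<phi>0) < 1"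
    and fp: "\<phi> \<in> fixed_points \<phi>0 \<phi>1 \<epsilon> \<rho>"
  shows "\<exists>a z. el_solution \<epsilon> (\<lambda>x. integral {0..x} \<rho>) \<phi>0 a \<phi> z \<and> \<phi> 1 = \<phi>1"
proof -
  have \<phi>: "set_integrable lebesgue {0..1} (\<lambda>z. logistic (- \<phi> z))"
    using fp potential_space_mono set_integrable_logistic_mono unfolding fixed_points_def by blast
  note W = log_weight_continuous[OF \<rho> \<phi> \<epsilon>]
  have A: "0 < A_const \<phi>0 \<phi>1 \<rho> \<epsilon> \<phi> \<and> K_with \<phi>0 \<rho> \<epsilon> \<phi> (A_const \<phi>0 \<phi>1 \<rho> \<epsilon> \<phi>) 1 = \<phi>1"
    unfolding A_const_def by (rule theI'[OF A_const_ex1[OF \<rho> \<phi> \<epsilon> pq]])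
  define a where "a = ln (A_const \<phi>0 \<phi>1 \<rho> \<epsilon> \<phi>)"
  have a: "A_const \<phi>0 \<phi>1 \<rho> \<epsilon> \<phi> = exp a" using A by (simp add: a_def)
  have K: "\<phi> = (\<lambda>x\<in>{0..1}. K_with \<phi>0 \<rho> \<epsilon> \<phi> (exp a) x)"
    using fp by (simp add: fixed_points_def K_op_def a)
  have \<phi>_eq: "\<phi> x = \<phi>0 + integral {0..x} (\<lambda>y. logistic (a + log_weight \<rho> \<epsilon> \<phi> y)) / \<epsilon>" if "x \<in> {0..1}" for x
    using fun_cong[OF K, of x] K_with_exp[OF \<rho> \<phi> \<epsilon> that, of \<phi>0 a] that by (simp del: atLeastAtMost_iff)
  have d: "(\<phi> has_real_derivative logistic (a + log_weight \<rho> \<epsilon> \<phi> x) / \<epsilon>) (at x within {0..1})"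
    if x: "x \<in> {0..1}" for x
  proof -
    have "((\<lambda>x. integral {0..x} (\<lambda>y. logistic (a + log_weight \<rho> \<epsilon> \<phi> y))) has_real_derivative
        logistic (a + log_weight \<rho> \<epsilon> \<phi> x)) (at x within {0..1})"
      using x W by (intro integral_has_real_derivative[where g = "\<lambda>y. logistic (a + log_weight \<rho> \<epsilon> \<phi> y)"] continuous_intros)
    from DERIV_add[OF DERIV_const[of \<phi>0] DERIV_cdivide[OF this, of \<epsilon>]]
    show ?thesis
      by (rule DERIV_cong[OF has_field_derivative_transform_within[OF _ zero_less_one x]])
        (auto simp: \<phi>_eq)
  qed
  have cont: "continuous_on {0..1} \<phi>" by (rule DERIV_continuous_on[OF d])
  define z where "z x = a + integral {0..x} (\<lambda>y. logistic (- \<phi> y)) / \<epsilon>" for x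
  have "(z has_real_derivative logistic (- \<phi> x) / \<epsilon>) (at x within {0..1})" if x: "x \<in> {0..1}" for x
  proof -
    have "((\<lambda>x. integral {0..x} (\<lambda>y. logistic (- \<phi> y))) has_real_derivative logistic (- \<phi> x)) (at x within {0..1})"
      using x cont by (intro integral_has_real_derivative[where g = "\<lambda>y. logistic (- \<phi> y)"] continuous_intros)
    from DERIV_add[OF DERIV_const[of a] DERIV_cdivide[OF this, of \<epsilon>]] show ?thesis
      by (simp add: z_def[abs_def])
  qed
  moreover have "a + log_weight \<rho> \<epsilon> \<phi> x = z x - integral {0..x} \<rho> / \<epsilon>" for x
    by (simp add: z_def log_weight_def diff_divide_distrib)
  moreover have "\<phi> 0 = \<phi>0" "z 0 = a" using \<phi>_eq[of 0] by (simp_all add: z_def)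
  ultimately have "el_solution \<epsilon> (\<lambda>x. integral {0..x} \<rho>) \<phi>0 a \<phi> z"
    using d by (simp add: el_solution_def)
  moreover have "\<phi> 1 = \<phi>1" using A a fun_cong[OF K, of 1] by simp
  ultimately show ?thesis by blast
qed

text \<open>Integrating the two equations recovers the operator with constant \<open>exp a\<close>.
  The restriction matches the extensional encoding of potentials.\<close>

lemma el_solution_imp_fixed_point:
  assumes \<rho>: "\<rho> \<in> density_space" and \<epsilon>: "0 < \<epsilon>" and pq: "\<phi>0 < \<phi>1" "\<epsilon> * (\<phi>1 - \<phi>0) < 1"
    and sol: "el_solution \<epsilon> (\<lambda>x. integral {0..x} \<rho>) \<phi>0 a f z" and f1: "f 1 = \<phi>1"
  shows "restrict f {0..1} \<in> fixed_points \<phi>0 \<phi>1 \<epsilon> \<rho>"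
proof -
  note S = el_solutionD[OF sol]
  define \<phi> where "\<phi> = restrict f {0..1}"
  have cont: "continuous_on {0..1} f" "continuous_on {0..1} z"
    by (rule DERIV_continuous_on[OF S(3)] DERIV_continuous_on[OF S(4)], assumption)+
  have R: "continuous_on {0..1} (\<lambda>x. integral {0..x} \<rho>)"
    using set_lebesgue_integral_eq_integral(1)[OF density_space_integrable[OF \<rho>]]
    by (rule indefinite_integral_continuous_1)
  have pot: "\<phi> \<in> potential_space \<phi>0 \<phi>1"
    unfolding \<phi>_def using S f1 cont R \<epsilon>
    by (intro potential_spaceI[OF S(3)] continuous_intros) (auto simp: less_imp_le)
  then have \<phi>: "set_integrable lebesgue {0..1} (\<lambda>z. logistic (- \<phi> z))"
    by (intro set_integrable_logistic_mono potential_space_mono)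
  have zW: "z x - integral {0..x} \<rho> / \<epsilon> = a + log_weight \<rho> \<epsilon> \<phi> x" if x: "x \<in> {0..1}" for x
  proof -
    have "((\<lambda>y. logistic (- f y) / \<epsilon>) has_integral (z x - z 0)) {0..x}"
      using x by (intro FTC_within[OF _ _ S(4)]) auto
    from integral_unique[OF this] have "integral {0..x} (\<lambda>y. logistic (- f y)) / \<epsilon> = z x - a"
      using S(2) by simp
    moreover have "integral {0..x} (\<lambda>y. logistic (- f y)) = integral {0..x} (\<lambda>y. logistic (- \<phi> y))"
      using x by (intro integral_cong) (auto simp: \<phi>_def)
    ultimately show ?thesis by (simp add: log_weight_def diff_divide_distrib)
  qed
  have K: "K_with \<phi>0 \<rho> \<epsilon> \<phi> (exp a) x = f x" if x: "x \<in> {0..1}" for x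
  proof -
    have "((\<lambda>y. logistic (z y - integral {0..y} \<rho> / \<epsilon>) / \<epsilon>) has_integral (f x - f 0)) {0..x}"
      using x by (intro FTC_within[OF _ _ S(3)]) auto
    from integral_unique[OF this]
    have "integral {0..x} (\<lambda>y. logistic (z y - integral {0..y} \<rho> / \<epsilon>)) / \<epsilon> = f x - \<phi>0"
      using S(1) by simp
    moreover have "integral {0..x} (\<lambda>y. logistic (z y - integral {0..y} \<rho> / \<epsilon>))
        = integral {0..x} (\<lambda>y. logistic (a + log_weight \<rho> \<epsilon> \<phi> y))"
      using x by (intro integral_cong) (simp add: zW)
    ultimately show ?thesis using K_with_exp[OF \<rho> \<phi> \<epsilon> x, of \<phi>0 a] by simp
  qed
  \<comment> \<open>The end condition at 1 together with uniqueness identifies the constant.\<close>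
  have "A_const \<phi>0 \<phi>1 \<rho> \<epsilon> \<phi> = exp a"
    unfolding A_const_def using K[of 1] f1
    by (intro the1_equality[OF A_const_ex1[OF \<rho> \<phi> \<epsilon> pq]]) auto
  then have "K_op \<phi>0 \<phi>1 \<rho> \<epsilon> \<phi> = \<phi>"
    using K by (auto simp: K_op_def fun_eq_iff \<phi>_def restrict_def)
  then show ?thesis using pot by (simp add: fixed_points_def \<phi>_def)
qed

section \<open>Criteria for a unique fixed point\<close>

text \<open>Shooting gives a fixed point. For two of them, excluding both strict orders of the
  initial values of \<open>z\<close> leaves \<open>a = b\<close>, and stability makes the solutions
  agree on \<open>{0..1}\<close>.\<close>

lemma fixed_points_singletonI:
  assumes \<rho>: "\<rho> \<in> density_space" and \<epsilon>: "0 < \<epsilon>" and pq: "\<phi>0 < \<phi>1" "\<epsilon> * (\<phi>1 - \<phi>0) < 1"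
    and no_crossing: "\<And>a b f g z u. el_solution \<epsilon> (\<lambda>x. integral {0..x} \<rho>) \<phi>0 a f z \<Longrightarrow> f 1 = \<phi>1 \<Longrightarrow>
      el_solution \<epsilon> (\<lambda>x. integral {0..x} \<rho>) \<phi>0 b g u \<Longrightarrow> g 1 = \<phi>1 \<Longrightarrow> \<not> a < b"
  shows "is_singleton (fixed_points \<phi>0 \<phi>1 \<epsilon> \<rho>)"
proof (rule is_singletonI')
  have "continuous_on {0..1} (\<lambda>x. integral {0..x} \<rho>)"
    using set_lebesgue_integral_eq_integral(1)[OF density_space_integrable[OF \<rho>]]
    by (rule indefinite_integral_continuous_1)
  then obtain a f z where "el_solution \<epsilon> (\<lambda>x. integral {0..x} \<rho>) \<phi>0 a f z" "f 1 = \<phi>1"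
    using el_boundary_solution_exists[OF \<epsilon> pq] density_space_primitive_bounds[OF \<rho>] by blast
  then show "fixed_points \<phi>0 \<phi>1 \<epsilon> \<rho> \<noteq> {}"
    using el_solution_imp_fixed_point[OF \<rho> \<epsilon> pq] by blast
next
  fix \<phi> \<psi> assume fp: "\<phi> \<in> fixed_points \<phi>0 \<phi>1 \<epsilon> \<rho>" "\<psi> \<in> fixed_points \<phi>0 \<phi>1 \<epsilon> \<rho>"
  obtain a z where f: "el_solution \<epsilon> (\<lambda>x. integral {0..x} \<rho>) \<phi>0 a \<phi> z" "\<phi> 1 = \<phi>1"
    using fixed_point_imp_el_solution[OF \<rho> \<epsilon> pq fp(1)] by blast
  obtain b u where g: "el_solution \<epsilon> (\<lambda>x. integral {0..x} \<rho>) \<phi>0 b \<psi> u" "\<psi> 1 = \<phi>1"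
    using fixed_point_imp_el_solution[OF \<rho> \<epsilon> pq fp(2)] by blast
  have "a = b" using no_crossing[OF f g] no_crossing[OF g f] by simp
  then have "\<phi> x = \<psi> x" if "x \<in> {0..1}" for x
    using el_solution_stable[OF \<epsilon> f(1) g(1) that] by simp
  moreover have "\<phi> \<in> extensional {0..1}" "\<psi> \<in> extensional {0..1}"
    using fp by (auto simp: fixed_points_def potential_space_def)
  ultimately show "\<phi> = \<psi>" by (intro extensionalityI)
qed

text \<open>The minimum lets one criterion serve two regimes:
  \<open>\<epsilon> * (\<phi>1 - \<phi>0)\<close> close to 1 and close to 0.\<close>

lemma fixed_points_singleton_if_small:
  assumes "\<rho> \<in> density_space" and \<epsilon>: "0 < \<epsilon>" and "\<phi>0 < \<phi>1" "\<epsilon> * (\<phi>1 - \<phi>0) < 1"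
    and small: "exp (2 / \<epsilon>) * min (\<epsilon> * (\<phi>1 - \<phi>0)) (1 - \<epsilon> * (\<phi>1 - \<phi>0)) < 2 * \<epsilon>\<^sup>2"
  shows "is_singleton (fixed_points \<phi>0 \<phi>1 \<epsilon> \<rho>)"
  using assms density_space_primitive_bounds
  by (intro fixed_points_singletonI no_crossing_if_small[OF \<epsilon> _ _ _ _ _ small])

text \<open>The problem sees \<open>\<rho>\<close> only through its primitive, which is also the
  primitive of the continuous representative \<open>r\<close>.\<close>

lemma fixed_points_singleton_if_mono:
  assumes \<rho>: "\<rho> \<in> density_space" and \<epsilon>: "0 < \<epsilon>" and pq: "\<phi>0 < \<phi>1" "\<epsilon> * (\<phi>1 - \<phi>0) < 1"
    and ae: "AE x in lebesgue_on {0..1}. \<rho> x = r x" and C1: "C1_unit_interval r" and mono: "mono_on {0..1} r"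
  shows "is_singleton (fixed_points \<phi>0 \<phi>1 \<epsilon> \<rho>)"
proof -
  obtain r' where r': "\<And>x. x \<in> {0..1} \<Longrightarrow> (r has_real_derivative r' x) (at x within {0..1})"
    using C1 unfolding C1_unit_interval_def by blast
  have "AE x in lebesgue. x \<in> {0..1} \<longrightarrow> \<rho> x = r x"
    by (rule AE_restrict_space_iff[THEN iffD1, rotated, OF ae]) simp
  then have ae': "AE x in lborel. x \<in> {0..1} \<longrightarrow> \<rho> x = r x" by (simp only: AE_completion_iff)
  have eq: "integral {0..x} \<rho> = integral {0..x} r" if "x \<in> {0..1}" for x
  proof -
    have "AE y in lborel. y \<in> {0..x} \<longrightarrow> \<rho> y = r y"
      using ae' by eventually_elim (use that in auto)
    then have "(\<rho> has_integral i) {0..x} = (r has_integral i) {0..x}" for i by (rule has_integral_AE)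
    then show ?thesis by (simp add: integral_def integrable_on_def)
  qed
  have R: "((\<lambda>x. integral {0..x} \<rho>) has_real_derivative r x) (at x within {0..1})" if x: "x \<in> {0..1}" for x
    using integral_has_real_derivative[OF DERIV_continuous_on[OF r'] x]
    by (rule has_field_derivative_transform_within[OF _ zero_less_one x]) (simp_all add: eq)
  show ?thesis
    using no_crossing_if_mono[OF \<epsilon> _ _ _ _ _ R r' mono]
    by (intro fixed_points_singletonI[OF \<rho> \<epsilon> pq]) auto
qed

theorem theorem2p4:
  shows
    "(\<forall>\<phi>0 \<phi>1 :: real. \<phi>0 < \<phi>1 \<longrightarrow>
         (\<exists>\<epsilon>1. 0 < \<epsilon>1 \<and> \<epsilon>1 < 1 / (\<phi>1 - \<phi>0) \<and>
           (\<forall>\<epsilon>. \<epsilon>1 < \<epsilon> \<and> \<epsilon> < 1 / (\<phi>1 - \<phi>0) \<longrightarrow>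
             (\<forall>\<rho>\<in>density_space. is_singleton (fixed_points \<phi>0 \<phi>1 \<epsilon> \<rho>))))) \<and>
     (\<forall>\<epsilon> :: real. 0 < \<epsilon> \<longrightarrow>
         (\<exists>\<delta>. 0 < \<delta> \<and> \<delta> < inverse \<epsilon> \<and>
           (\<forall>\<phi>0 \<phi>1. 0 < \<phi>1 - \<phi>0 \<and> \<phi>1 - \<phi>0 < \<delta> \<longrightarrow>
             (\<forall>\<rho>\<in>density_space. is_singleton (fixed_points \<phi>0 \<phi>1 \<epsilon> \<rho>))))) \<and>
     (\<forall>\<phi>0 \<phi>1 \<epsilon> :: real. \<phi>0 < \<phi>1 \<longrightarrow> 0 < \<epsilon> \<longrightarrow> \<epsilon> < 1 / (\<phi>1 - \<phi>0) \<longrightarrow>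
         (\<forall>\<rho>\<in>density_space.
           (\<exists>r. (AE x in lebesgue_on {0..1}. \<rho> x = r x) \<and>
                C1_unit_interval r \<and> strict_mono_on {0..1} r) \<longrightarrow>
           is_singleton (fixed_points \<phi>0 \<phi>1 \<epsilon> \<rho>)))"
proof (intro conjI allI impI ballI)
  fix \<phi>0 \<phi>1 :: real assume lt: "\<phi>0 < \<phi>1"
  let ?e = "1 / (\<phi>1 - \<phi>0)"
  have e: "0 < ?e" using lt by simp
  \<comment> \<open>At the critical value the factor
    \<open>1 - \<epsilon> * (\<phi>1 - \<phi>0)\<close> vanishes, so the limit is positive and the
    smallness condition holds on a left neighbourhood.\<close>
  have "((\<lambda>\<epsilon>. 2 * \<epsilon>\<^sup>2 - exp (2 / \<epsilon>) * (1 - \<epsilon> * (\<phi>1 - \<phi>0))) \<longlongrightarrow> 2 * ?e\<^sup>2 - exp (2 / ?e) * (1 - ?e * (\<phi>1 - \<phi>0))) (at_left ?e)"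
    using e by (intro tendsto_intros) auto
  moreover have "0 < 2 * ?e\<^sup>2 - exp (2 / ?e) * (1 - ?e * (\<phi>1 - \<phi>0))" using lt by simp
  ultimately have "\<forall>\<^sub>F \<epsilon> in at_left ?e. 0 < 2 * \<epsilon>\<^sup>2 - exp (2 / \<epsilon>) * (1 - \<epsilon> * (\<phi>1 - \<phi>0))"
    by (rule order_tendstoD(1))
  then obtain b where b: "b < ?e"
    "\<And>\<epsilon>. b < \<epsilon> \<Longrightarrow> \<epsilon> < ?e \<Longrightarrow> 0 < 2 * \<epsilon>\<^sup>2 - exp (2 / \<epsilon>) * (1 - \<epsilon> * (\<phi>1 - \<phi>0))"
    unfolding eventually_at_left[OF e] by blast
  show "\<exists>\<epsilon>1. 0 < \<epsilon>1 \<and> \<epsilon>1 < ?e \<and> (\<forall>\<epsilon>. \<epsilon>1 < \<epsilon> \<and> \<epsilon> < ?e \<longrightarrow>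
             (\<forall>\<rho>\<in>density_space. is_singleton (fixed_points \<phi>0 \<phi>1 \<epsilon> \<rho>)))"
  \<comment> \<open>The maximum with \<open>?e / 2\<close> keeps the threshold positive.\<close>
  proof (intro exI[of _ "max b (?e / 2)"] conjI allI impI ballI)
    fix \<epsilon> \<rho> assume h: "max b (?e / 2) < \<epsilon> \<and> \<epsilon> < ?e" and \<rho>: "\<rho> \<in> density_space"
    from h have \<epsilon>: "0 < \<epsilon>" "b < \<epsilon>" "\<epsilon> < ?e"
      unfolding max_less_iff_conj using half_gt_zero[OF e] less_trans by blast+
    then have "\<epsilon> * (\<phi>1 - \<phi>0) < 1" using lt by (simp only: pos_less_divide_eq diff_gt_0_iff_gt)
    have "exp (2 / \<epsilon>) * min (\<epsilon> * (\<phi>1 - \<phi>0)) (1 - \<epsilon> * (\<phi>1 - \<phi>0)) \<le> exp (2 / \<epsilon>) * (1 - \<epsilon> * (\<phi>1 - \<phi>0))"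
      by (intro mult_left_mono) auto
    also have "\<dots> < 2 * \<epsilon>\<^sup>2" using b(2)[OF \<epsilon>(2,3)] by simp
    finally show "is_singleton (fixed_points \<phi>0 \<phi>1 \<epsilon> \<rho>)"
      by (rule fixed_points_singleton_if_small[OF \<rho> \<epsilon>(1) lt \<open>\<epsilon> * (\<phi>1 - \<phi>0) < 1\<close>])
  next
    show "0 < max b (?e / 2)" using half_gt_zero[OF e] by (rule less_max_iff_disj[THEN iffD2, OF disjI2])
    have "y / 2 < y" if "0 < y" for y :: real using that by simp
    from this[OF e] show "max b (?e / 2) < ?e" unfolding max_less_iff_conj using b(1) by blast
  qed
next
  fix \<epsilon> :: real assume \<epsilon>: "0 < \<epsilon>"
  \<comment> \<open>The first bound keeps \<open>?d\<close> below \<open>inverse \<epsilon>\<close>;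
    the second gives \<open>exp (2 / \<epsilon>) * (\<epsilon> * ?d) \<le>
    \<epsilon>\<^sup>2\<close>, which is less than \<open>2 * \<epsilon>\<^sup>2\<close>.\<close>
  let ?d = "min (1 / (2 * \<epsilon>)) (\<epsilon> / exp (2 / \<epsilon>))"
  show "\<exists>\<delta>. 0 < \<delta> \<and> \<delta> < inverse \<epsilon> \<and> (\<forall>\<phi>0 \<phi>1. 0 < \<phi>1 - \<phi>0 \<and> \<phi>1 - \<phi>0 < \<delta> \<longrightarrow>
             (\<forall>\<rho>\<in>density_space. is_singleton (fixed_points \<phi>0 \<phi>1 \<epsilon> \<rho>)))"
  proof (intro exI[of _ ?d] conjI allI impI ballI)
    fix \<phi>0 \<phi>1 \<rho> assume h: "0 < \<phi>1 - \<phi>0 \<and> \<phi>1 - \<phi>0 < ?d" and \<rho>: "\<rho> \<in> density_space"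
    have "exp (2 / \<epsilon>) * min (\<epsilon> * (\<phi>1 - \<phi>0)) (1 - \<epsilon> * (\<phi>1 - \<phi>0)) \<le> exp (2 / \<epsilon>) * (\<epsilon> * (\<phi>1 - \<phi>0))"
      by (intro mult_left_mono) auto
    also have "\<dots> \<le> exp (2 / \<epsilon>) * (\<epsilon> * (\<epsilon> / exp (2 / \<epsilon>)))"
      using h \<epsilon> by (intro mult_left_mono) auto
    also have "\<dots> < 2 * \<epsilon>\<^sup>2" using \<epsilon> by (simp add: power2_eq_square)
    finally have small: "exp (2 / \<epsilon>) * min (\<epsilon> * (\<phi>1 - \<phi>0)) (1 - \<epsilon> * (\<phi>1 - \<phi>0)) < 2 * \<epsilon>\<^sup>2" .
    have "\<epsilon> * (\<phi>1 - \<phi>0) < \<epsilon> * (1 / (2 * \<epsilon>))" using h \<epsilon> by (intro mult_strict_left_mono) auto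
    then show "is_singleton (fixed_points \<phi>0 \<phi>1 \<epsilon> \<rho>)"
      using \<epsilon> h by (intro fixed_points_singleton_if_small[OF \<rho> \<epsilon> _ _ small]) auto
  next
    have "1 / (2 * \<epsilon>) < inverse \<epsilon>" using \<epsilon> by (simp add: inverse_eq_divide divide_strict_left_mono)
    then show "?d < inverse \<epsilon>" by simp
  qed (use \<epsilon> in simp)
next
  fix \<phi>0 \<phi>1 \<epsilon> :: real and \<rho>
  assume lt: "\<phi>0 < \<phi>1" and \<epsilon>: "0 < \<epsilon>" "\<epsilon> < 1 / (\<phi>1 - \<phi>0)" and \<rho>: "\<rho> \<in> density_space"
    and "\<exists>r. (AE x in lebesgue_on {0..1}. \<rho> x = r x) \<and> C1_unit_interval r \<and> strict_mono_on {0..1} r"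
  then obtain r where "AE x in lebesgue_on {0..1}. \<rho> x = r x" "C1_unit_interval r" "strict_mono_on {0..1} r"
    by blast
  moreover have "\<epsilon> * (\<phi>1 - \<phi>0) < 1" using \<epsilon> lt by (simp only: pos_less_divide_eq diff_gt_0_iff_gt)
  ultimately show "is_singleton (fixed_points \<phi>0 \<phi>1 \<epsilon> \<rho>)"
    by (intro fixed_points_singleton_if_mono[OF \<rho> \<epsilon>(1) lt] strict_mono_on_imp_mono_on)
qed

end
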